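(* Let $\kappa>0$ and let $\bar g$ be a static and axisymmetric solution of the four-dimensional vacuum Einstein equations, of Lorentzian signature $(-,+,+,+)$, which in local coordinates $x^\mu=(x^0,x^i)=(\eta,x^i)$, $i=1,2,3$, has the form $$d\bar s^2=\bar g_{00}\,d\eta^2+\bar h_{ij}\,dx^i dx^j ,\qquad \partial_0\bar g_{\mu\nu}=0=\bar g_{i0},$$ i.e. no component depends on $\eta$ and there are no mixed components $\bar g_{i0}$ (here $\eta$ is a single coordinate, either timelike or spacelike, and $\bar g_{00}$ is nowhere zero on the domain considered). Let $\epsilon=-1$ if $\eta$ is timelike and $\epsilon=+1$ if $\eta$ is spacelike, so that $\bar g_{00}=\epsilon|\bar g_{00}|$. Let $\beta\in(-1,1)$, put $$\xi_0=\sqrt{\frac{1-\beta^2}{2\kappa}},$$ and let $V_0,\xi_1,\xi_2,\xi_3$ be real constants satisfying $$\xi_1=-\xi_3=\frac{\beta}{\xi_0},\qquad (\beta^2-2\xi_0^2\kappa)\,\xi_2=2\xi_0^2\kappa,\qquad (2\xi_0^2\kappa-\beta^2)^2\,V_0=2\epsilon\,\xi_0^2C^2(\beta^2-6\xi_0^2\kappa),$$ where $C,B$ are free real constants. (In particular the sign in the last relation is $-$ if $\eta$ is timelike and $+$ if $\eta$ is spacelike.) Then, on the region where $C\eta+B>0$, the $\eta$-dependent pair $(\tilde g,\tilde\phi)$ defined by $$d\tilde s^2=e^{2\mu(\eta)}\left[\epsilon\,|\bar g_{00}|^{\beta}\,d\eta^2+|\bar g_{00}|^{1-\beta}\,\bar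 h_{ij}\,dx^i dx^j\right],$$ $$\tilde\phi=\xi_0\ln|\bar g_{00}|+\frac{\xi_1}{\kappa}\,\mu(\eta),\qquad \mu(\eta)=\xi_2\ln(C\eta+B),$$ solves the Einstein–scalar system with self-interacting potential $V(\tilde\phi)=V_0e^{\xi_3\tilde\phi}$.
   Context: The Einstein–scalar system with self-interacting potential $V$, for a four-dimensional Lorentzian metric $\tilde g$ of signature $(-,+,+,+)$ and a real scalar field $\tilde\phi$, is $$\tilde G_{\mu\nu}=\kappa\left[\partial_\mu\tilde\phi\,\partial_\nu\tilde\phi-\tilde g_{\mu\nu}\left(\tfrac12\tilde g^{\alpha\beta}\partial_\alpha\tilde\phi\,\partial_\beta\tilde\phi+V(\tilde\phi)\right)\right],\qquad \tilde\Box\tilde\phi=\frac{dV}{d\tilde\phi}(\tilde\phi),$$ where $\tilde G_{\mu\nu}$ is the Einstein tensor of $\tilde g$, $\tilde\Box=\tilde g^{\mu\nu}\tilde\nabla_\mu\tilde\nabla_\nu$, and $\kappa=8\pi G>0$. The vacuum Einstein equations for $\bar g$ are $\bar R_{\mu\nu}=0$. *)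

theory Defs
  imports "HOL-Analysis.Analysis"
begin

text \<open>
  Tensor calculus in a single coordinate chart, i.e. on an open set of \<open>real ^ 4\<close>.  Coordinates are
  indexed by the four-element type \<open>4\<close>, whose elements are \<open>0, 1, 2, 3\<close>; \<open>x $ 0\<close> is the coordinate
  \<open>\<eta> = x\<^sup>0\<close> and the indices \<open>i \<noteq> 0\<close> are the remaining ones.  Tensor components written as
  functions of indices and of a point take the point last.
\<close>

type_synonym scalar = "real ^ 4 \<Rightarrow> real"
type_synonym vfield = "real ^ 4 \<Rightarrow> real ^ 4"
type_synonym metric = "real ^ 4 \<Rightarrow> real ^ 4 ^ 4"

definition pd :: "4 \<Rightarrow> scalar \<Rightarrow> scalar" where
  "pd i f x = deriv (\<lambda>t. f (x + t *\<^sub>R axis i 1)) 0"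

primrec Ck_on :: "nat \<Rightarrow> (real ^ 4) set \<Rightarrow> scalar \<Rightarrow> bool" where
  "Ck_on 0 U f \<longleftrightarrow> continuous_on U f"
| "Ck_on (Suc k) U f \<longleftrightarrow> f differentiable_on U \<and> (\<forall>i. Ck_on k U (pd i f))"

definition smooth_on :: "(real ^ 4) set \<Rightarrow> scalar \<Rightarrow> bool" where
  "smooth_on U f \<longleftrightarrow> (\<forall>k. Ck_on k U f)"

definition smooth_vfield_on :: "(real ^ 4) set \<Rightarrow> vfield \<Rightarrow> bool" where
  "smooth_vfield_on U X \<longleftrightarrow> (\<forall>\<mu>. smooth_on U (\<lambda>x. X x $ \<mu>))"


subsection \<open>Lorentzian metrics and curvature\<close>

definition minkowski :: "real ^ 4 ^ 4" where
  "minkowski = (\<chi> \<mu> \<nu>. if \<mu> \<noteq> \<nu> then 0 else if \<mu> = 0 then - 1 else 1)"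

text \<open>
  Signature \<open>(-,+,+,+)\<close> refers to the quadratic form, not to the order of the coordinates: the
  coordinate \<open>x $ 0\<close> need not be timelike.
\<close>

definition lorentzian :: "real ^ 4 ^ 4 \<Rightarrow> bool" where
  "lorentzian A \<longleftrightarrow>
     transpose A = A \<and> (\<exists>P. invertible P \<and> transpose P ** A ** P = minkowski)"

definition lorentz_metric_on :: "(real ^ 4) set \<Rightarrow> metric \<Rightarrow> bool" where
  "lorentz_metric_on U g \<longleftrightarrow>
     (\<forall>\<mu> \<nu>. smooth_on U (\<lambda>x. g x $ \<mu> $ \<nu>)) \<and> (\<forall>x\<in>U. lorentzian (g x))"

definition ginv :: "metric \<Rightarrow> 4 \<Rightarrow> 4 \<Rightarrow> scalar" where
  "ginv g \<mu> \<nu> x = matrix_inv (g x) $ \<mu> $ \<nu>"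

text \<open>\<open>christoffel g \<lambda> \<mu> \<nu>\<close> is \<open>\<Gamma>\<^sup>\<lambda>\<^bsub>\<mu>\<nu>\<^esub>\<close>.\<close>

definition christoffel :: "metric \<Rightarrow> 4 \<Rightarrow> 4 \<Rightarrow> 4 \<Rightarrow> scalar" where
  "christoffel g l \<mu> \<nu> x =
     (\<Sum>\<rho>\<in>UNIV. ginv g l \<rho> x / 2 *
        (pd \<mu> (\<lambda>y. g y $ \<rho> $ \<nu>) x + pd \<nu> (\<lambda>y. g y $ \<rho> $ \<mu>) x - pd \<rho> (\<lambda>y. g y $ \<mu> $ \<nu>) x))"

text \<open>
  \<open>riemann g \<rho> \<sigma> \<mu> \<nu>\<close> is \<open>R\<^sup>\<rho>\<^bsub>\<sigma>\<mu>\<nu>\<^esub>\<close>, with the sign convention in which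
  the Ricci tensor of a round sphere is positive, as the sign of the matter term requires.
\<close>

definition riemann :: "metric \<Rightarrow> 4 \<Rightarrow> 4 \<Rightarrow> 4 \<Rightarrow> 4 \<Rightarrow> scalar" where
  "riemann g \<rho> \<sigma> \<mu> \<nu> x =
     pd \<mu> (christoffel g \<rho> \<nu> \<sigma>) x - pd \<nu> (christoffel g \<rho> \<mu> \<sigma>) x
     + (\<Sum>l\<in>UNIV. christoffel g \<rho> \<mu> l x * christoffel g l \<nu> \<sigma> x
                 - christoffel g \<rho> \<nu> l x * christoffel g l \<mu> \<sigma> x)"

definition ricci :: "metric \<Rightarrow> 4 \<Rightarrow> 4 \<Rightarrow> scalar" where
  "ricci g \<mu> \<nu> x = (\<Sum>\<rho>\<in>UNIV. riemann g \<rho> \<mu> \<rho> \<nu> x)"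

definition scalar_curvature :: "metric \<Rightarrow> scalar" where
  "scalar_curvature g x = (\<Sum>\<mu>\<in>UNIV. \<Sum>\<nu>\<in>UNIV. ginv g \<mu> \<nu> x * ricci g \<mu> \<nu> x)"

definition einstein :: "metric \<Rightarrow> 4 \<Rightarrow> 4 \<Rightarrow> scalar" where
  "einstein g \<mu> \<nu> x = ricci g \<mu> \<nu> x - scalar_curvature g x / 2 * g x $ \<mu> $ \<nu>"

definition box :: "metric \<Rightarrow> scalar \<Rightarrow> scalar" where
  "box g \<phi> x = (\<Sum>\<mu>\<in>UNIV. \<Sum>\<nu>\<in>UNIV. ginv g \<mu> \<nu> x *
     (pd \<mu> (pd \<nu> \<phi>) x - (\<Sum>l\<in>UNIV. christoffel g l \<mu> \<nu> x * pd l \<phi> x)))"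


subsection \<open>Field equations\<close>

definition vacuum_solution :: "(real ^ 4) set \<Rightarrow> metric \<Rightarrow> bool" where
  "vacuum_solution U g \<longleftrightarrow>
     lorentz_metric_on U g \<and> (\<forall>x\<in>U. \<forall>\<mu> \<nu>. ricci g \<mu> \<nu> x = 0)"

definition einstein_scalar_solution ::
    "real \<Rightarrow> (real \<Rightarrow> real) \<Rightarrow> (real ^ 4) set \<Rightarrow> metric \<Rightarrow> scalar \<Rightarrow> bool" where
  "einstein_scalar_solution \<kappa> V U g \<phi> \<longleftrightarrow>
     lorentz_metric_on U g \<and> smooth_on U \<phi> \<and>
     (\<forall>x\<in>U.
        (\<forall>\<mu> \<nu>. einstein g \<mu> \<nu> x =
           \<kappa> * (pd \<mu> \<phi> x * pd \<nu> \<phi> x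
                - g x $ \<mu> $ \<nu> *
                  (1 / 2 * (\<Sum>\<alpha>\<in>UNIV. \<Sum>\<beta>\<in>UNIV. ginv g \<alpha> \<beta> x * pd \<alpha> \<phi> x * pd \<beta> \<phi> x) + V (\<phi> x))))
        \<and> box g \<phi> x = deriv V (\<phi> x))"


subsection \<open>Static and axisymmetric metrics\<close>

definition gprod :: "metric \<Rightarrow> vfield \<Rightarrow> vfield \<Rightarrow> scalar" where
  "gprod g X Y x = (\<Sum>\<mu>\<in>UNIV. \<Sum>\<nu>\<in>UNIV. g x $ \<mu> $ \<nu> * X x $ \<mu> * Y x $ \<nu>)"

definition lower :: "metric \<Rightarrow> vfield \<Rightarrow> 4 \<Rightarrow> scalar" where
  "lower g X \<mu> x = (\<Sum>\<nu>\<in>UNIV. g x $ \<mu> $ \<nu> * X x $ \<nu>)"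

text \<open>\<open>(L\<^sub>X g)\<^bsub>\<mu>\<nu>\<^esub> = 0\<close>.\<close>

definition killing_on :: "(real ^ 4) set \<Rightarrow> metric \<Rightarrow> vfield \<Rightarrow> bool" where
  "killing_on U g X \<longleftrightarrow> smooth_vfield_on U X \<and>
     (\<forall>x\<in>U. \<forall>\<mu> \<nu>.
        (\<Sum>l\<in>UNIV. X x $ l * pd l (\<lambda>y. g y $ \<mu> $ \<nu>) x
           + g x $ l $ \<nu> * pd \<mu> (\<lambda>y. X y $ l) x
           + g x $ \<mu> $ l * pd \<nu> (\<lambda>y. X y $ l) x) = 0)"

text \<open>Frobenius condition \<open>X\<^bsub>[\<lambda>\<^esub>\<partial>\<^bsub>\<mu>\<^esub>X\<^bsub>\<nu>]\<^esub> = 0\<close> for the one-form dual to \<open>X\<close>.\<close>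

definition hypersurface_orthogonal_on :: "(real ^ 4) set \<Rightarrow> metric \<Rightarrow> vfield \<Rightarrow> bool" where
  "hypersurface_orthogonal_on U g X \<longleftrightarrow>
     (\<forall>x\<in>U. \<forall>l \<mu> \<nu>.
        lower g X l x * (pd \<mu> (lower g X \<nu>) x - pd \<nu> (lower g X \<mu>) x)
      + lower g X \<mu> x * (pd \<nu> (lower g X l) x - pd l (lower g X \<nu>) x)
      + lower g X \<nu> x * (pd l (lower g X \<mu>) x - pd \<mu> (lower g X l) x) = 0)"

definition commute_on :: "(real ^ 4) set \<Rightarrow> vfield \<Rightarrow> vfield \<Rightarrow> bool" where
  "commute_on U X Y \<longleftrightarrow>
     (\<forall>x\<in>U. \<forall>\<mu>. (\<Sum>l\<in>UNIV. X x $ l * pd l (\<lambda>y. Y y $ \<mu>) x - Y x $ l * pd l (\<lambda>y. X y $ \<mu>) x) = 0)"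

definition static_field_on :: "(real ^ 4) set \<Rightarrow> metric \<Rightarrow> vfield \<Rightarrow> bool" where
  "static_field_on U g X \<longleftrightarrow>
     killing_on U g X \<and> (\<forall>x\<in>U. gprod g X X x < 0) \<and> hypersurface_orthogonal_on U g X"

text \<open>
  The generator of the rotations, normalised to period \<open>2\<pi>\<close>, seen in a chart: it is a spacelike Killing
  field away from the axis (its zero set), and an orbit which stays in the chart for one
  period is closed.
\<close>

definition axial_field_on :: "(real ^ 4) set \<Rightarrow> metric \<Rightarrow> vfield \<Rightarrow> bool" where
  "axial_field_on U g Y \<longleftrightarrow>
     killing_on U g Y \<and>
     interior {x \<in> U. Y x = 0} = {} \<and>
     (\<forall>x\<in>U. Y x \<noteq> 0 \<longrightarrow> gprod g Y Y x > 0) \<and>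
     (\<forall>\<gamma>. (\<forall>t\<in>{0..2 * pi}. \<gamma> t \<in> U \<and> (\<gamma> has_vector_derivative Y (\<gamma> t)) (at t within {0..2 * pi}))
           \<longrightarrow> \<gamma> (2 * pi) = \<gamma> 0)"

definition static_axisymmetric_on :: "(real ^ 4) set \<Rightarrow> metric \<Rightarrow> bool" where
  "static_axisymmetric_on U g \<longleftrightarrow>
     (\<exists>X Y. static_field_on U g X \<and> axial_field_on U g Y \<and> commute_on U X Y)"

end

(*
  Let u = ln |g_00|, and let h be the spatial part of g.  Both g and the new metric belong to the family
  m_00 = eps exp(2 mu + b u), m_ij = exp(2 mu + (1 - b) u) h_ij, the vacuum metric being the
  member b = 1, mu = 0.  Expressed through Delta u, |du|^2, Hess u and the Ricci expression of h,
  the Ricci tensor of this family is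

    R_00 = - 3 mu'' - (eps b / 2) exp((2 b - 1) u) (Delta u + |du|^2 / 2),
    R_0i = b mu' u_i,
    R_ij = Ric(h)_ij - Hess(u)_ij / 2 - (1 - b) / 2 h_ij (Delta u + |du|^2 / 2)
           + (1/4 - b^2/2) u_i u_j - eps exp((1 - 2 b) u) h_ij (mu'' + 2 mu'^2).

  For b = 1 and mu = 0 the vacuum equations thus say that Delta u + |du|^2 / 2 = 0 and that
  Ric(h) - Hess(u) / 2 = du du / 4.  For b = beta only algebraic terms remain, and they match the
  trace-reversed source kappa (d phi d phi + V g) by the relations between the constants.
*)
theory Submission
  imports Defs
begin

section \<open>Partial derivatives and smoothness in a chart\<close>

text \<open>The exponents \<open>b\<close> and \<open>1 - b\<close> of the two blocks are what makes
  the comparison possible. The eta direction contributes weight b/2 and the conformal factor of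
  \<open>h\<close> weight (1 - b)/2, and these always add up to 1/2. Hence Hess(u) enters R_ij with
  a coefficient free of \<open>b\<close>, and the bracket Delta u + |du|^2 / 2 has the same form for
  every \<open>b\<close>; what is known at b = 1 can be inserted at b = beta.

  The constants come from matching coefficients. The u_i u_j terms give 1/4 + 1/4 - beta^2/2 = kappa
  xi0^2, the mixed terms xi0 xi1 = beta. The h_ij terms fix kappa V = - eps exp(-2 mu - beta u)
  (mu'' + 2 mu'^2), whose dependence on u forces xi3 = - beta / xi0. R_00 then leaves (xi1^2 / kappa
  - 2) mu'^2 = - 2 mu'', which a logarithm solves, and the same relation for xi2 makes V an exact
  exponential of phi.

  The wave equation is computed separately, because the contracted Bianchi identity would give it
  only where d phi is nonzero.\<close>

lemma pd_line:
  assumes "f differentiable (at (y + s *\<^sub>R axis i 1))"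
  shows "((\<lambda>t. f (y + t *\<^sub>R axis i 1)) has_field_derivative pd i f (y + s *\<^sub>R axis i 1)) (at s)"
proof -
  obtain D where D: "(f has_derivative D) (at (y + s *\<^sub>R axis i 1))"
    using assms unfolding differentiable_def by blast
  \<comment> \<open>Free in base point and parameter: used at base y + s e_i with parameter 0 to
    evaluate \<open>pd\<close>, and at base y with parameter s for the claim. Derivatives away from
    0 are what the mean value theorem in \<open>second_difference\<close> needs.\<close>
  have line: "((\<lambda>t. f (y + t *\<^sub>R axis i 1)) has_field_derivative D (axis i 1)) (at s)"
    if D: "(f has_derivative D) (at (y + s *\<^sub>R axis i 1))" for y s
  proof -
    have l: "((\<lambda>t. y + t *\<^sub>R axis i 1) has_derivative (\<lambda>t. t *\<^sub>R axis i 1)) (at s)"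
      by (auto intro!: derivative_eq_intros)
    have "((\<lambda>t. f (y + t *\<^sub>R axis i 1)) has_derivative (\<lambda>t. D (t *\<^sub>R axis i 1))) (at s)"
      using has_derivative_compose[OF l D] .
    moreover have "(\<lambda>t. D (t *\<^sub>R axis i 1)) = (*) (D (axis i 1))"
      using linear_cmul[OF has_derivative_linear[OF D]] by (auto simp: mult.commute)
    ultimately show ?thesis by (simp add: has_field_derivative_def)
  qed
  have "pd i f (y + s *\<^sub>R axis i 1) = D (axis i 1)"
    unfolding pd_def by (rule DERIV_imp_deriv) (rule line, use D in simp)
  with line[OF D] show ?thesis by simp
qed

lemma pd_has_derivative:
  assumes "f differentiable (at x)"
  shows "((\<lambda>t. f (x + t *\<^sub>R axis i 1)) has_field_derivative pd i f x) (at 0)"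
  using pd_line[of f x 0 i] assms by simp

lemma pd_eqI:
  "((\<lambda>t. f (x + t *\<^sub>R axis i 1)) has_field_derivative D) (at 0) \<Longrightarrow> pd i f x = D"
  unfolding pd_def by (rule DERIV_imp_deriv)

text \<open>Pointwise identities are available only on an open set; a short piece of the coordinate
  line through \<open>x\<close> stays inside it, so they may still be differentiated.\<close>

lemma pd_cong:
  assumes "open W" "x \<in> W" "\<And>y. y \<in> W \<Longrightarrow> f y = g y"
  shows "pd i f x = pd i g x"
proof -
  have "((\<lambda>t. x + t *\<^sub>R axis i 1) \<longlongrightarrow> x + 0 *\<^sub>R axis i 1) (nhds (0::real))"
    by (intro tendsto_intros filterlim_ident)
  then have "eventually (\<lambda>t. x + t *\<^sub>R axis i 1 \<in> W) (nhds (0::real))"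
    using assms by (auto dest: topological_tendstoD)
  then show ?thesis
    unfolding pd_def by (intro deriv_cong_ev refl) (auto elim!: eventually_mono simp: assms)
qed

lemma pd_const [simp]: "pd i (\<lambda>y. c) x = 0"
  by (rule pd_eqI) simp

lemma pd_add:
  assumes "f differentiable (at x)" "g differentiable (at x)"
  shows "pd i (\<lambda>y. f y + g y) x = pd i f x + pd i g x"
  by (rule pd_eqI) (intro derivative_intros pd_has_derivative assms)

lemma pd_diff:
  assumes "f differentiable (at x)" "g differentiable (at x)"
  shows "pd i (\<lambda>y. f y - g y) x = pd i f x - pd i g x"
  by (rule pd_eqI) (intro derivative_intros pd_has_derivative assms)

lemma pd_minus:
  assumes "f differentiable (at x)"
  shows "pd i (\<lambda>y. - f y) x = - pd i f x"
  by (rule pd_eqI) (intro derivative_intros pd_has_derivative assms)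

lemma pd_mult:
  assumes "f differentiable (at x)" "g differentiable (at x)"
  shows "pd i (\<lambda>y. f y * g y) x = pd i f x * g x + f x * pd i g x"
  by (rule pd_eqI)
    (use DERIV_mult[OF pd_has_derivative[OF assms(1)] pd_has_derivative[OF assms(2)]]
     in \<open>simp add: algebra_simps\<close>)

lemma pd_cmult:
  assumes "f differentiable (at x)"
  shows "pd i (\<lambda>y. c * f y) x = c * pd i f x"
  using pd_mult[of "\<lambda>y. c" x f] assms by simp

lemma pd_divide_const:
  assumes "f differentiable (at x)"
  shows "pd i (\<lambda>y. f y / c) x = pd i f x / c"
  using pd_cmult[OF assms, of i "1 / c"] by simp

lemma pd_sum:
  assumes "finite A" "\<And>a. a \<in> A \<Longrightarrow> f a differentiable (at x)"
  shows "pd i (\<lambda>y. \<Sum>a\<in>A. f a y) x = (\<Sum>a\<in>A. pd i (f a) x)"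
  by (rule pd_eqI) (intro derivative_intros pd_has_derivative assms)

lemma pd_comp:
  assumes "f differentiable (at x)" "(F has_field_derivative D) (at (f x))"
  shows "pd i (\<lambda>y. F (f y)) x = D * pd i f x"
  by (rule pd_eqI) (use DERIV_chain2[OF _ pd_has_derivative[OF assms(1)], of F D] assms(2) in simp)

lemma pd_nth: "pd i (\<lambda>y. y $ j) x = (if i = j then 1 else 0)"
  by (rule pd_eqI) (auto intro!: derivative_eq_intros simp: axis_def)

lemma nth_differentiable: "(\<lambda>y::real^4. y $ j) differentiable F"
  by (intro bounded_linear_imp_differentiable bounded_linear_vec_nth)

lemma differentiable_comp_real:
  fixes f :: scalar
  assumes "f differentiable (at x)" "(F has_field_derivative D) (at (f x))"
  shows "(\<lambda>y. F (f y)) differentiable (at x)"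
  using differentiable_compose[of F f x UNIV] assms
  by (auto simp: has_field_derivative_def differentiable_def)

section \<open>The classes \<open>Ck_on\<close> and \<open>smooth_on\<close> under elementary
  operations\<close>

lemma Ck_on_cong:
  assumes "open W" "\<And>y. y \<in> W \<Longrightarrow> f y = g y"
  shows "Ck_on k W f \<longleftrightarrow> Ck_on k W g"
  using assms(2)
proof (induction k arbitrary: f g)
  case 0
  then show ?case by (simp cong: continuous_on_cong)
next
  case (Suc k)
  have "Ck_on k W (pd i f) \<longleftrightarrow> Ck_on k W (pd i g)" for i
    by (rule Suc.IH) (rule pd_cong[OF assms(1)], auto simp: Suc.prems)
  moreover have "f differentiable_on W \<longleftrightarrow> g differentiable_on W"
    using differentiable_transform_within[of _ _ W 1] Suc.prems
    unfolding differentiable_on_def by (metis zero_less_one)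
  ultimately show ?case by simp
qed

lemma Ck_on_SucD: "Ck_on (Suc k) W f \<Longrightarrow> Ck_on k W f"
  by (induction k arbitrary: f) (auto simp: differentiable_imp_continuous_on)

lemma Ck_on_subset: "Ck_on k W f \<Longrightarrow> T \<subseteq> W \<Longrightarrow> Ck_on k T f"
  by (induction k arbitrary: f) (auto intro: continuous_on_subset differentiable_on_subset)

lemma Ck_on_const: "Ck_on k W (\<lambda>y. c)"
proof (induction k arbitrary: c)
  case (Suc k)
  then show ?case by (simp add: pd_const[abs_def])
qed simp

lemma Ck_on_nth: "Ck_on k W (\<lambda>y. y $ j)"
proof (cases k)
  case (Suc k')
  then show ?thesis
    by (simp add: Ck_on_const pd_nth[abs_def] nth_differentiable differentiable_on_def)
qed (simp add: continuous_on_component)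

lemma Ck_on_add:
  assumes "open W"
  shows "Ck_on k W f \<Longrightarrow> Ck_on k W g \<Longrightarrow> Ck_on k W (\<lambda>y. f y + g y)"
proof (induction k arbitrary: f g)
  case (Suc k)
  have "Ck_on k W (pd i (\<lambda>y. f y + g y))" for i
    using Suc assms
    by (subst Ck_on_cong[OF assms, where g = "\<lambda>y. pd i f y + pd i g y"])
      (auto simp: pd_add differentiable_on_eq_differentiable_at)
  then show ?case using Suc.prems by simp
qed (simp add: continuous_on_add)

lemma Ck_on_mult:
  assumes "open W"
  shows "Ck_on k W f \<Longrightarrow> Ck_on k W g \<Longrightarrow> Ck_on k W (\<lambda>y. f y * g y)"
proof (induction k arbitrary: f g)
  case (Suc k)
  have "Ck_on k W (pd i (\<lambda>y. f y * g y))" for i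
    using Suc.prems assms Ck_on_SucD[OF Suc.prems(1)] Ck_on_SucD[OF Suc.prems(2)]
    by (subst Ck_on_cong[OF assms, where g = "\<lambda>y. pd i f y * g y + f y * pd i g y"])
      (auto simp: pd_mult differentiable_on_eq_differentiable_at intro!: Ck_on_add Suc.IH)
  then show ?case using Suc.prems by simp
qed (simp add: continuous_on_mult)

lemma Ck_on_exp:
  assumes "open W"
  shows "Ck_on k W f \<Longrightarrow> Ck_on k W (\<lambda>y. exp (f y))"
proof (induction k arbitrary: f)
  case (Suc k)
  then have diff: "f differentiable (at x)" if "x \<in> W" for x
    using that assms by (simp add: differentiable_on_eq_differentiable_at)
  have "Ck_on k W (pd i (\<lambda>y. exp (f y)))" for i
    using Suc.prems Suc.IH[OF Ck_on_SucD[OF Suc.prems]]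
    by (subst Ck_on_cong[OF assms, where g = "\<lambda>y. exp (f y) * pd i f y"])
      (auto simp: pd_comp[OF diff DERIV_exp] intro!: Ck_on_mult[OF assms])
  moreover have "(\<lambda>y. exp (f y)) differentiable_on W"
    using assms differentiable_comp_real[OF diff DERIV_exp]
    by (simp add: differentiable_on_eq_differentiable_at)
  ultimately show ?case by simp
qed (simp add: continuous_on_exp)

lemma Ck_on_inverse:
  assumes "open W" "\<And>y. y \<in> W \<Longrightarrow> f y \<noteq> 0"
  shows "Ck_on k W f \<Longrightarrow> Ck_on k W (\<lambda>y. inverse (f y))"
proof (induction k)
  case (Suc k)
  then have diff: "f differentiable (at x)" if "x \<in> W" for x
    using that assms by (simp add: differentiable_on_eq_differentiable_at)
  note inv = Suc.IH[OF Ck_on_SucD[OF Suc.prems]]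
  have "Ck_on k W (\<lambda>y. - 1 * (inverse (f y) * inverse (f y)) * pd i f y)" for i
    using Suc.prems by (intro Ck_on_mult[OF assms(1)] Ck_on_const inv) simp
  then have "Ck_on k W (pd i (\<lambda>y. inverse (f y)))" for i
    by (rule Ck_on_cong[THEN iffD2, rotated 2])
      (use assms in \<open>auto simp: pd_comp[OF diff DERIV_inverse] power2_eq_square\<close>)
  moreover have "(\<lambda>y. inverse (f y)) differentiable_on W"
    using assms differentiable_comp_real[OF diff DERIV_inverse]
    by (simp add: differentiable_on_eq_differentiable_at)
  ultimately show ?case by simp
qed (use assms in \<open>simp add: continuous_on_inverse\<close>)

text \<open>No induction: the derivative is \<open>inverse (f y) * pd i f y\<close>, which the lemma
  on inverses already covers.\<close>

lemma Ck_on_ln: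
  assumes "open W" "\<And>y. y \<in> W \<Longrightarrow> f y > 0" "Ck_on k W f"
  shows "Ck_on k W (\<lambda>y. ln (f y))"
proof (cases k)
  case 0
  then show ?thesis using assms by (force intro!: continuous_on_ln)
next
  case (Suc k')
  then have diff: "f differentiable (at x)" if "x \<in> W" for x
    using that assms by (simp add: differentiable_on_eq_differentiable_at)
  have "Ck_on k' W (\<lambda>y. inverse (f y) * pd i f y)" for i
    using assms(2,3) Ck_on_SucD[of k' W f] Suc
    by (intro Ck_on_mult[OF assms(1)] Ck_on_inverse[OF assms(1)]) (auto simp: less_imp_neq[THEN not_sym])
  then have "Ck_on k' W (pd i (\<lambda>y. ln (f y)))" for i
    by (rule Ck_on_cong[THEN iffD2, rotated 2])
      (use assms in \<open>auto simp: pd_comp[OF diff DERIV_ln]\<close>)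
  moreover have "(\<lambda>y. ln (f y)) differentiable_on W"
    using assms differentiable_comp_real[OF diff DERIV_ln]
    by (simp add: differentiable_on_eq_differentiable_at)
  ultimately show ?thesis using Suc by simp
qed

lemma smooth_on_cong:
  "open W \<Longrightarrow> (\<And>y. y \<in> W \<Longrightarrow> f y = g y) \<Longrightarrow> smooth_on W f \<longleftrightarrow> smooth_on W g"
  unfolding smooth_on_def using Ck_on_cong by blast

lemma smooth_on_subset: "smooth_on W f \<Longrightarrow> T \<subseteq> W \<Longrightarrow> smooth_on T f"
  unfolding smooth_on_def using Ck_on_subset by blast

lemma smooth_on_const: "smooth_on W (\<lambda>y. c)"
  and smooth_on_nth: "smooth_on W (\<lambda>y. y $ j)"
  and smooth_on_add: "open W \<Longrightarrow> smooth_on W f \<Longrightarrow> smooth_on W g \<Longrightarrow> smooth_on W (\<lambda>y. f y + g y)"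
  and smooth_on_mult: "open W \<Longrightarrow> smooth_on W f \<Longrightarrow> smooth_on W g \<Longrightarrow> smooth_on W (\<lambda>y. f y * g y)"
  and smooth_on_exp: "open W \<Longrightarrow> smooth_on W f \<Longrightarrow> smooth_on W (\<lambda>y. exp (f y))"
  and smooth_on_inverse:
    "open W \<Longrightarrow> (\<And>y. y \<in> W \<Longrightarrow> f y \<noteq> 0) \<Longrightarrow> smooth_on W f \<Longrightarrow> smooth_on W (\<lambda>y. inverse (f y))"
  and smooth_on_ln:
    "open W \<Longrightarrow> (\<And>y. y \<in> W \<Longrightarrow> f y > 0) \<Longrightarrow> smooth_on W f \<Longrightarrow> smooth_on W (\<lambda>y. ln (f y))"
  unfolding smooth_on_def
  by (simp_all add: Ck_on_const Ck_on_nth Ck_on_add Ck_on_mult Ck_on_exp Ck_on_inverse Ck_on_ln)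

lemma smooth_on_sum:
  assumes "open W" "\<And>a. a \<in> A \<Longrightarrow> smooth_on W (f a)"
  shows "smooth_on W (\<lambda>y. \<Sum>a\<in>A. f a y)"
  using assms(2)
  by (induction A rule: infinite_finite_induct) (auto intro: smooth_on_const smooth_on_add[OF assms(1)])

lemma smooth_on_prod:
  assumes "open W" "\<And>a. a \<in> A \<Longrightarrow> smooth_on W (f a)"
  shows "smooth_on W (\<lambda>y. \<Prod>a\<in>A. f a y)"
  using assms(2)
  by (induction A rule: infinite_finite_induct) (auto intro: smooth_on_const smooth_on_mult[OF assms(1)])

lemma smooth_on_pd: "smooth_on W f \<Longrightarrow> smooth_on W (pd i f)"
  unfolding smooth_on_def using Ck_on.simps(2) by blast

lemma smooth_on_differentiable:
  assumes "open W" "smooth_on W f" "x \<in> W"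
  shows "f differentiable (at x)"
  using assms Ck_on.simps(2)[of 0 W f]
  by (auto simp: smooth_on_def differentiable_on_eq_differentiable_at simp del: Ck_on.simps)

text \<open>The second difference is the increment over [0, d] of \<open>?\<phi>\<close>, the
  difference of \<open>f\<close> along two parallel segments in direction i. One mean value step in
  direction i and one in direction j turn it into a mixed derivative at an intermediate point. The
  difference is symmetric in i and j while the order of differentiation is not;
  \<open>pd_commute\<close> exploits this.\<close>

lemma second_difference:
  assumes "open W" "smooth_on W f" "ball x r \<subseteq> W" "0 < d" "2 * d < r"
  shows "\<exists>y\<in>cball x (2 * d).
    f (x + d *\<^sub>R axis i 1 + d *\<^sub>R axis j 1) - f (x + d *\<^sub>R axis i 1) - f (x + d *\<^sub>R axis j 1) + f x
      = d * d * pd j (pd i f) y"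
proof -
  have near: "x + s *\<^sub>R axis i 1 + t *\<^sub>R axis j 1 \<in> cball x (2 * d)"
    if "0 \<le> s" "s \<le> d" "0 \<le> t" "t \<le> d" for s t
    using norm_triangle_ineq[of "s *\<^sub>R axis i (1::real)" "t *\<^sub>R axis j 1"] that
    by (simp add: dist_norm norm_minus_commute algebra_simps)
  have inW: "x + s *\<^sub>R axis i 1 + t *\<^sub>R axis j 1 \<in> W"
    if "0 \<le> s" "s \<le> d" "0 \<le> t" "t \<le> d" for s t
    using near[OF that] assms by (auto simp: subset_iff)
  have inW': "x + d *\<^sub>R axis j 1 + s *\<^sub>R axis i 1 \<in> W" "x + s *\<^sub>R axis i 1 \<in> W"
    if "0 \<le> s" "s \<le> d" for s
    using inW[of s d] inW[of s 0] that assms(4) by (simp_all add: ac_simps)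
  note diff = smooth_on_differentiable[OF assms(1)]
  let ?\<phi> = "\<lambda>s. f (x + d *\<^sub>R axis j 1 + s *\<^sub>R axis i 1) - f (x + s *\<^sub>R axis i 1)"
  have "\<exists>s. 0 < s \<and> s < d \<and> ?\<phi> d - ?\<phi> 0 = (d - 0) *
      (pd i f (x + d *\<^sub>R axis j 1 + s *\<^sub>R axis i 1) - pd i f (x + s *\<^sub>R axis i 1))"
    using assms(4) inW'
    by (intro MVT2) (auto intro!: derivative_intros pd_line diff[OF assms(2)])
  then obtain s where s: "0 < s" "s < d" "?\<phi> d - ?\<phi> 0 = d *
      (pd i f (x + d *\<^sub>R axis j 1 + s *\<^sub>R axis i 1) - pd i f (x + s *\<^sub>R axis i 1))"
    by auto
  let ?\<psi> = "\<lambda>t. pd i f (x + s *\<^sub>R axis i 1 + t *\<^sub>R axis j 1)"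
  have "\<exists>t. 0 < t \<and> t < d \<and> ?\<psi> d - ?\<psi> 0 = (d - 0) *
      pd j (pd i f) (x + s *\<^sub>R axis i 1 + t *\<^sub>R axis j 1)"
    using s inW assms(4)
    by (intro MVT2) (auto intro!: pd_line diff[OF smooth_on_pd[OF assms(2)]])
  then obtain t where t: "0 < t" "t < d"
    "?\<psi> d - ?\<psi> 0 = d * pd j (pd i f) (x + s *\<^sub>R axis i 1 + t *\<^sub>R axis j 1)"
    by auto
  show ?thesis
  proof (rule bexI)
    show "x + s *\<^sub>R axis i 1 + t *\<^sub>R axis j 1 \<in> cball x (2 * d)"
      using near s t by simp
    show "f (x + d *\<^sub>R axis i 1 + d *\<^sub>R axis j 1) - f (x + d *\<^sub>R axis i 1) - f (x + d *\<^sub>R axis j 1) + f x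
      = d * d * pd j (pd i f) (x + s *\<^sub>R axis i 1 + t *\<^sub>R axis j 1)"
      using s(3) t(3) by (simp add: add_ac)
  qed
qed

text \<open>Schwarz's theorem: both mixed derivatives are limits of the same second difference quotient.\<close>

lemma pd_commute:
  assumes "open W" "smooth_on W f" "x \<in> W"
  shows "pd i (pd j f) x = pd j (pd i f) x"
proof (rule ccontr)
  let ?A = "pd i (pd j f)" and ?B = "pd j (pd i f)"
  \<comment> \<open>Half the gap: the two derivatives take a common value at points where each is
    within \<open>e\<close> of its value at \<open>x\<close>, so the gap would be smaller than 2 *
    e.\<close>
  define e where "e = \<bar>?A x - ?B x\<bar> / 2"
  assume "?A x \<noteq> ?B x"
  then have e: "e > 0" by (simp add: e_def)
  have cont: "continuous_on W ?A" "continuous_on W ?B"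
    using smooth_on_pd[OF smooth_on_pd[OF assms(2)]] Ck_on.simps(1) unfolding smooth_on_def by blast+
  obtain r where r: "r > 0" "ball x r \<subseteq> W"
    using assms openE by blast
  have near: "\<exists>d>0. \<forall>y\<in>W. dist y x < d \<longrightarrow> \<bar>F y - F x\<bar> < e" if "continuous_on W F" for F :: scalar
    using that assms(3) e unfolding continuous_on_iff by (auto simp: dist_real_def)
  obtain d1 where d1: "d1 > 0" "\<And>y. y \<in> W \<Longrightarrow> dist y x < d1 \<Longrightarrow> \<bar>?A y - ?A x\<bar> < e"
    using near[OF cont(1)] by blast
  obtain d2 where d2: "d2 > 0" "\<And>y. y \<in> W \<Longrightarrow> dist y x < d2 \<Longrightarrow> \<bar>?B y - ?B x\<bar> < e"
    using near[OF cont(2)] by blast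
  define d where "d = min r (min d1 d2) / 3"
  have d: "0 < d" "2 * d < r" "2 * d < d1" "2 * d < d2"
    using r d1 d2 by (auto simp: d_def)
  obtain y where y: "y \<in> cball x (2 * d)"
    "f (x + d *\<^sub>R axis i 1 + d *\<^sub>R axis j 1) - f (x + d *\<^sub>R axis i 1) - f (x + d *\<^sub>R axis j 1) + f x
      = d * d * ?B y"
    using second_difference[OF assms(1,2) r(2) d(1,2)] by blast
  obtain z where z: "z \<in> cball x (2 * d)"
    "f (x + d *\<^sub>R axis j 1 + d *\<^sub>R axis i 1) - f (x + d *\<^sub>R axis j 1) - f (x + d *\<^sub>R axis i 1) + f x
      = d * d * ?A z"
    using second_difference[OF assms(1,2) r(2) d(1,2)] by blast
  have "x + d *\<^sub>R axis j 1 + d *\<^sub>R axis i 1 = x + d *\<^sub>R axis i 1 + d *\<^sub>R axis j (1::real)"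
    by (simp add: add_ac)
  from y(2) z(2)[unfolded this] have "d * d * ?A z = d * d * ?B y" by linarith
  then have "?A z = ?B y" using d(1) by simp
  moreover have "\<bar>?A z - ?A x\<bar> < e" "\<bar>?B y - ?B x\<bar> < e"
    using y(1) z(1) d r by (auto intro!: d1 d2 simp: dist_commute subset_iff)
  ultimately have "\<bar>?A x - ?B x\<bar> < e + e"
    by (simp add: abs_less_iff)
  then show False by (simp add: e_def)
qed

section \<open>Index algebra of a conformal change of connection\<close>

abbreviation spatial :: "4 set" where
  "spatial \<equiv> - {0}"

lemma sum_split_0: "(\<Sum>\<rho>\<in>UNIV. f \<rho>) = f 0 + (\<Sum>i\<in>spatial. f i)" for f :: "4 \<Rightarrow> real"
  using sum.remove[of UNIV 0 f] by (simp add: Compl_eq_Diff_UNIV)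

lemma card_spatial [simp]: "card spatial = 3"
  by (simp add: Compl_eq_Diff_UNIV card_Diff_singleton)

text \<open>
  The change of the Christoffel symbols of \<open>h\<close> when \<open>h\<close> is multiplied by \<open>exp (2 * a * f)\<close>, where
  \<open>u\<close> is the differential of \<open>f\<close> and \<open>w\<close> its gradient with respect to \<open>h\<close>.
\<close>

definition conformal_shift ::
    "real \<Rightarrow> (4 \<Rightarrow> real) \<Rightarrow> (4 \<Rightarrow> real) \<Rightarrow> (4 \<Rightarrow> 4 \<Rightarrow> real) \<Rightarrow> 4 \<Rightarrow> 4 \<Rightarrow> 4 \<Rightarrow> real" where
  "conformal_shift a u w h l i j =
     a * ((if l = i then u j else 0) + (if l = j then u i else 0) - h i j * w l)"

context
  fixes a :: real and u w :: "4 \<Rightarrow> real" and h :: "4 \<Rightarrow> 4 \<Rightarrow> real"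
  assumes h_sym: "\<And>i j. i \<noteq> 0 \<Longrightarrow> j \<noteq> 0 \<Longrightarrow> h i j = h j i"
    and h_w: "\<And>i. i \<noteq> 0 \<Longrightarrow> (\<Sum>j\<in>spatial. h i j * w j) = u i"
begin

private abbreviation "S \<equiv> conformal_shift a u w h"

lemma shift_sym: "i \<noteq> 0 \<Longrightarrow> j \<noteq> 0 \<Longrightarrow> S l i j = S l j i"
  by (simp add: conformal_shift_def h_sym)

text \<open>The covector \<open>p\<close> is arbitrary because \<open>quadratic_shift\<close>
  contracts not only with \<open>u\<close> but also with rows of \<gamma> and of the shift
  itself.\<close>

lemma contract_shift:
  assumes "i \<noteq> 0" "j \<noteq> 0"
  shows "(\<Sum>l\<in>spatial. p l * S l i j)
    = a * (p i * u j + p j * u i - h i j * (\<Sum>l\<in>spatial. p l * w l))"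
proof -
  have "(\<Sum>l\<in>spatial. p l * S l i j) = (\<Sum>l\<in>spatial. a * ((if l = i then p l * u j else 0)
      + (if l = j then p l * u i else 0) - h i j * (p l * w l)))"
    by (intro sum.cong) (auto simp: conformal_shift_def algebra_simps)
  also have "\<dots> = a * ((\<Sum>l\<in>spatial. if l = i then p l * u j else 0)
      + (\<Sum>l\<in>spatial. if l = j then p l * u i else 0) - h i j * (\<Sum>l\<in>spatial. p l * w l))"
    by (simp only: sum.distrib sum_subtractf flip: sum_distrib_left)
  finally show ?thesis using assms by simp
qed

text \<open>The factor 3 is the dimension: it comes from the first delta, while the second delta and
  the term with \<open>h\<close> cancel by \<open>h_w\<close>.\<close>

lemma trace_shift:
  assumes "j \<noteq> 0"
  shows "(\<Sum>l\<in>spatial. S l l j) = 3 * a * u j"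
proof -
  have "(\<Sum>l\<in>spatial. S l l j) = (\<Sum>l\<in>spatial. a * (u j + (if l = j then u l else 0) - h j l * w l))"
    using assms h_sym by (intro sum.cong) (auto simp: conformal_shift_def)
  also have "\<dots> = a * (3 * u j + (\<Sum>l\<in>spatial. if l = j then u l else 0) - (\<Sum>l\<in>spatial. h j l * w l))"
    by (simp add: sum.distrib sum_subtractf flip: sum_distrib_left)
  finally show ?thesis using assms by (simp add: h_w)
qed

text \<open>The terms u_i w^r from the second delta and from h_il w^l cancel, which leaves a
  multiple of the identity.\<close>

lemma shift_w:
  assumes "i \<noteq> 0" "r \<noteq> 0"
  shows "(\<Sum>l\<in>spatial. S r i l * w l) = (if r = i then a * (\<Sum>l\<in>spatial. u l * w l) else 0)"
proof -
  have "(\<Sum>l\<in>spatial. S r i l * w l) = (\<Sum>l\<in>spatial. a * ((if r = i then u l * w l else 0)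
      + (if l = r then u i * w l else 0) - w r * (h i l * w l)))"
    by (intro sum.cong) (auto simp: conformal_shift_def algebra_simps)
  also have "\<dots> = a * ((\<Sum>l\<in>spatial. if r = i then u l * w l else 0)
      + (\<Sum>l\<in>spatial. if l = r then u i * w l else 0) - w r * (\<Sum>l\<in>spatial. h i l * w l))"
    by (simp only: sum.distrib sum_subtractf flip: sum_distrib_left)
  finally show ?thesis using assms by (simp add: h_w)
qed

lemma quadratic_shift:
  fixes \<gamma> :: "4 \<Rightarrow> 4 \<Rightarrow> 4 \<Rightarrow> real"
  assumes \<gamma>_sym: "\<And>l i j. i \<noteq> 0 \<Longrightarrow> j \<noteq> 0 \<Longrightarrow> \<gamma> l i j = \<gamma> l j i"
    and assms: "i \<noteq> 0" "j \<noteq> 0"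
  shows "(\<Sum>r\<in>spatial. \<Sum>l\<in>spatial.
        (\<gamma> r r l + S r r l) * (\<gamma> l j i + S l j i) - (\<gamma> r j l + S r j l) * (\<gamma> l r i + S l r i))
    = (\<Sum>r\<in>spatial. \<Sum>l\<in>spatial. \<gamma> r r l * \<gamma> l j i - \<gamma> r j l * \<gamma> l r i)
      + a * ((\<Sum>l\<in>spatial. u l * \<gamma> l j i)
        - h i j * (\<Sum>r\<in>spatial. \<Sum>l\<in>spatial. \<gamma> r r l * w l)
        + (\<Sum>l\<in>spatial. w l * (\<Sum>r\<in>spatial. h r i * \<gamma> r l j + h j r * \<gamma> r l i)))
      + a\<^sup>2 * (u i * u j - h i j * (\<Sum>l\<in>spatial. u l * w l))"
proof -
  let ?N = "spatial"
  \<comment> \<open>Facts 1 to 6 are the six sums that contain \<open>S\<close>. The traces of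
    \<gamma> multiplied by u_i and u_j in fact 1 cancel those in facts 4 and 5.\<close>
  have 1: "(\<Sum>r\<in>?N. \<Sum>l\<in>?N. \<gamma> r r l * S l j i)
      = a * ((\<Sum>r\<in>?N. \<gamma> r r j) * u i + (\<Sum>r\<in>?N. \<gamma> r r i) * u j - h i j * (\<Sum>r\<in>?N. \<Sum>l\<in>?N. \<gamma> r r l * w l))"
    using assms
    by (simp add: contract_shift sum.distrib sum_subtractf sum_distrib_right h_sym flip: sum_distrib_left)
  have swap: "(\<Sum>r\<in>?N. \<Sum>l\<in>?N. S r r l * p l) = 3 * a * (\<Sum>l\<in>?N. u l * p l)" for p
    by (subst sum.swap)
      (auto simp: trace_shift sum_distrib_left simp flip: sum_distrib_right intro!: sum.cong)
  have 2: "(\<Sum>r\<in>?N. \<Sum>l\<in>?N. S r r l * \<gamma> l j i) = 3 * a * (\<Sum>l\<in>?N. u l * \<gamma> l j i)"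
    by (rule swap)
  have 3: "(\<Sum>r\<in>?N. \<Sum>l\<in>?N. S r r l * S l j i)
      = 3 * a * (a * (2 * u i * u j - h i j * (\<Sum>l\<in>?N. u l * w l)))"
    using assms by (subst swap) (simp add: contract_shift h_sym)
  have 4: "(\<Sum>r\<in>?N. \<Sum>l\<in>?N. \<gamma> r j l * S l r i)
      = a * ((\<Sum>r\<in>?N. \<gamma> r r j) * u i + (\<Sum>l\<in>?N. u l * \<gamma> l j i)
        - (\<Sum>l\<in>?N. w l * (\<Sum>r\<in>?N. h r i * \<gamma> r l j)))"
  proof -
    have "(\<Sum>r\<in>?N. \<Sum>l\<in>?N. \<gamma> r j l * S l r i)
        = (\<Sum>r\<in>?N. a * (\<gamma> r r j * u i + u r * \<gamma> r j i - (\<Sum>l\<in>?N. w l * (h r i * \<gamma> r l j))))"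
      using assms by (intro sum.cong) (auto simp: contract_shift \<gamma>_sym[of j] sum_distrib_left mult_ac)
    also have "\<dots> = a * ((\<Sum>r\<in>?N. \<gamma> r r j) * u i + (\<Sum>l\<in>?N. u l * \<gamma> l j i)
        - (\<Sum>r\<in>?N. \<Sum>l\<in>?N. w l * (h r i * \<gamma> r l j)))"
      by (simp only: sum.distrib sum_subtractf sum_distrib_right flip: sum_distrib_left)
    also have "(\<Sum>r\<in>?N. \<Sum>l\<in>?N. w l * (h r i * \<gamma> r l j)) = (\<Sum>l\<in>?N. w l * (\<Sum>r\<in>?N. h r i * \<gamma> r l j))"
      by (subst sum.swap) (simp only: sum_distrib_left)
    finally show ?thesis .
  qed
  have 5: "(\<Sum>r\<in>?N. \<Sum>l\<in>?N. S r j l * \<gamma> l r i)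
      = a * ((\<Sum>r\<in>?N. \<gamma> r r i) * u j + (\<Sum>l\<in>?N. u l * \<gamma> l j i)
        - (\<Sum>l\<in>?N. w l * (\<Sum>r\<in>?N. h j r * \<gamma> r l i)))"
  proof -
    have "(\<Sum>r\<in>?N. \<Sum>l\<in>?N. S r j l * \<gamma> l r i) = (\<Sum>l\<in>?N. \<Sum>r\<in>?N. \<gamma> l r i * S r j l)"
      by (subst sum.swap) (simp only: mult.commute)
    also have "\<dots> = (\<Sum>l\<in>?N. a * (\<gamma> l l i * u j + u l * \<gamma> l j i - (\<Sum>r\<in>?N. w r * (h j l * \<gamma> l r i))))"
      using assms by (intro sum.cong) (auto simp: contract_shift sum_distrib_left mult_ac)
    also have "\<dots> = a * ((\<Sum>r\<in>?N. \<gamma> r r i) * u j + (\<Sum>l\<in>?N. u l * \<gamma> l j i)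
        - (\<Sum>l\<in>?N. \<Sum>r\<in>?N. w r * (h j l * \<gamma> l r i)))"
      by (simp only: sum.distrib sum_subtractf sum_distrib_right flip: sum_distrib_left)
    also have "(\<Sum>l\<in>?N. \<Sum>r\<in>?N. w r * (h j l * \<gamma> l r i)) = (\<Sum>l\<in>?N. w l * (\<Sum>r\<in>?N. h j r * \<gamma> r l i))"
      by (subst sum.swap) (simp only: sum_distrib_left)
    finally show ?thesis .
  qed
  have 6: "(\<Sum>r\<in>?N. \<Sum>l\<in>?N. S r j l * S l r i)
      = a * (3 * a * u j * u i + a * (2 * u i * u j - h i j * (\<Sum>l\<in>?N. u l * w l))
        - a * h i j * (\<Sum>l\<in>?N. u l * w l))"
  proof -
    have "(\<Sum>r\<in>?N. \<Sum>l\<in>?N. S r j l * S l r i)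
        = (\<Sum>r\<in>?N. a * (S r r j * u i + u r * S r j i
            - (if r = j then h r i * (a * (\<Sum>l\<in>?N. u l * w l)) else 0)))"
    proof (intro sum.cong refl)
      fix r assume r: "r \<in> ?N"
      \<comment> \<open>The row \<open>S r j l\<close> plays the covector \<open>p l\<close> of
        \<open>contract_shift\<close>; \<open>shift_w\<close> then evaluates its contraction with
        the gradient.\<close>
      have "(\<Sum>l\<in>?N. S r j l * S l r i) = a * (S r j r * u i + S r j i * u r
          - h r i * (if r = j then a * (\<Sum>l\<in>?N. u l * w l) else 0))"
        using assms r shift_w[of j r] by (simp add: contract_shift)
      then show "(\<Sum>l\<in>?N. S r j l * S l r i) = a * (S r r j * u i + u r * S r j i
          - (if r = j then h r i * (a * (\<Sum>l\<in>?N. u l * w l)) else 0))"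
        using assms r by (simp add: shift_sym[of j r] mult.commute)
    qed
    also have "\<dots> = a * ((\<Sum>r\<in>?N. S r r j) * u i + (\<Sum>r\<in>?N. u r * S r j i)
        - (\<Sum>r\<in>?N. if r = j then h r i * (a * (\<Sum>l\<in>?N. u l * w l)) else 0))"
      by (simp only: sum.distrib sum_subtractf sum_distrib_right flip: sum_distrib_left)
    finally show ?thesis
      using assms by (simp add: trace_shift contract_shift h_sym)
  qed
  have "(\<Sum>r\<in>?N. \<Sum>l\<in>?N.
        (\<gamma> r r l + S r r l) * (\<gamma> l j i + S l j i) - (\<gamma> r j l + S r j l) * (\<gamma> l r i + S l r i))
    = (\<Sum>r\<in>?N. \<Sum>l\<in>?N. \<gamma> r r l * \<gamma> l j i - \<gamma> r j l * \<gamma> l r i)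
      + (\<Sum>r\<in>?N. \<Sum>l\<in>?N. \<gamma> r r l * S l j i)
      + (\<Sum>r\<in>?N. \<Sum>l\<in>?N. S r r l * \<gamma> l j i)
      + (\<Sum>r\<in>?N. \<Sum>l\<in>?N. S r r l * S l j i)
      - (\<Sum>r\<in>?N. \<Sum>l\<in>?N. \<gamma> r j l * S l r i)
      - (\<Sum>r\<in>?N. \<Sum>l\<in>?N. S r j l * \<gamma> l r i)
      - (\<Sum>r\<in>?N. \<Sum>l\<in>?N. S r j l * S l r i)"
    unfolding sum.distrib[symmetric] sum_subtractf[symmetric]
    by (intro sum.cong refl) (simp add: algebra_simps)
  also have "\<dots> = (\<Sum>r\<in>?N. \<Sum>l\<in>?N. \<gamma> r r l * \<gamma> l j i - \<gamma> r j l * \<gamma> l r i)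
      + a * ((\<Sum>l\<in>?N. u l * \<gamma> l j i)
        - h i j * (\<Sum>r\<in>?N. \<Sum>l\<in>?N. \<gamma> r r l * w l)
        + ((\<Sum>l\<in>?N. w l * (\<Sum>r\<in>?N. h r i * \<gamma> r l j)) + (\<Sum>l\<in>?N. w l * (\<Sum>r\<in>?N. h j r * \<gamma> r l i))))
      + a\<^sup>2 * (u i * u j - h i j * (\<Sum>l\<in>?N. u l * w l))"
    unfolding 1 2 3 4 5 6 by (simp add: algebra_simps power2_eq_square)
  finally show ?thesis
    by (simp add: sum.distrib ring_distribs)
qed

end

section \<open>Curvature of block-diagonal metrics\<close>

text \<open>Takes arbitrary connection coefficients, so that the closed form \<open>conn\<close> can
  replace the Christoffel symbols before anything is differentiated.\<close>

definition ricci_of :: "(4 \<Rightarrow> 4 \<Rightarrow> 4 \<Rightarrow> scalar) \<Rightarrow> 4 \<Rightarrow> 4 \<Rightarrow> scalar" where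
  "ricci_of G \<mu> \<nu> x = (\<Sum>\<rho>\<in>UNIV. pd \<rho> (G \<rho> \<nu> \<mu>) x - pd \<nu> (G \<rho> \<rho> \<mu>) x
     + (\<Sum>l\<in>UNIV. G \<rho> \<rho> l x * G l \<nu> \<mu> x - G \<rho> \<nu> l x * G l \<rho> \<mu> x))"

lemma ricci_eq_ricci_of: "ricci g \<mu> \<nu> x = ricci_of (christoffel g) \<mu> \<nu> x"
  by (simp add: ricci_def riemann_def ricci_of_def)

lemma ricci_of_cong:
  assumes "open W" "x \<in> W" "\<And>l i j y. y \<in> W \<Longrightarrow> G l i j y = H l i j y"
  shows "ricci_of G \<mu> \<nu> x = ricci_of H \<mu> \<nu> x"
proof -
  have "pd k (G l i j) x = pd k (H l i j) x" for k l i j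
    using assms by (intro pd_cong)
  then show ?thesis using assms by (simp add: ricci_of_def)
qed

text \<open>Index 0 is separated in every contracted slot. For spatial i and j the final double sum
  is the expression treated by \<open>quadratic_shift\<close>.\<close>

lemma ricci_of_split:
  "ricci_of G i j x =
     pd 0 (G 0 j i) x + (\<Sum>l\<in>spatial. pd l (G l j i) x)
     - (pd j (G 0 0 i) x + (\<Sum>l\<in>spatial. pd j (G l l i) x))
     + (G 0 0 0 x * G 0 j i x - G 0 j 0 x * G 0 0 i x)
     + (\<Sum>l\<in>spatial. G 0 0 l x * G l j i x) - (\<Sum>l\<in>spatial. G 0 j l x * G l 0 i x)
     + (\<Sum>r\<in>spatial. G r r 0 x) * G 0 j i x - (\<Sum>r\<in>spatial. G r j 0 x * G 0 r i x)
     + (\<Sum>r\<in>spatial. \<Sum>l\<in>spatial. G r r l x * G l j i x - G r j l x * G l r i x)"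
  by (simp add: ricci_of_def sum_split_0 sum.distrib sum_subtractf flip: sum_distrib_right)
    (simp add: distrib_right)

text \<open>
  \<open>k\<close> is the inverse of \<open>h\<close>; both only matter for indices in \<open>spatial\<close>.  Mere differentiability of \<open>k\<close>
  suffices since its spatial derivatives never have to be computed: they stay hidden in those of \<open>\<gamma>\<close>
  and \<open>w\<close>.
\<close>

locale spatial_metric =
  fixes W :: "(real ^ 4) set" and h k :: "4 \<Rightarrow> 4 \<Rightarrow> scalar" and u :: scalar
  assumes open_W: "open W"
    and h_smooth: "i \<noteq> 0 \<Longrightarrow> j \<noteq> 0 \<Longrightarrow> smooth_on W (h i j)"
    and u_smooth: "smooth_on W u"
    and k_diff: "x \<in> W \<Longrightarrow> i \<noteq> 0 \<Longrightarrow> j \<noteq> 0 \<Longrightarrow> k i j differentiable (at x)"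
    and h_sym: "x \<in> W \<Longrightarrow> i \<noteq> 0 \<Longrightarrow> j \<noteq> 0 \<Longrightarrow> h i j x = h j i x"
    and hk: "x \<in> W \<Longrightarrow> i \<noteq> 0 \<Longrightarrow> j \<noteq> 0 \<Longrightarrow>
      (\<Sum>l\<in>spatial. h i l x * k l j x) = (if i = j then 1 else 0)"
    and kh: "x \<in> W \<Longrightarrow> i \<noteq> 0 \<Longrightarrow> j \<noteq> 0 \<Longrightarrow>
      (\<Sum>l\<in>spatial. k i l x * h l j x) = (if i = j then 1 else 0)"
    and h_static: "x \<in> W \<Longrightarrow> i \<noteq> 0 \<Longrightarrow> j \<noteq> 0 \<Longrightarrow> pd 0 (h i j) x = 0"
    and u_static: "x \<in> W \<Longrightarrow> pd 0 u x = 0"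
begin

text \<open>The Christoffel symbols of the three-dimensional slice, as functions on the
  four-dimensional chart; independence of eta makes the two viewpoints agree.\<close>

definition \<gamma> :: "4 \<Rightarrow> 4 \<Rightarrow> 4 \<Rightarrow> scalar" where
  "\<gamma> l i j x = (\<Sum>r\<in>spatial. k l r x / 2 * (pd i (h r j) x + pd j (h r i) x - pd r (h i j) x))"

definition w :: "4 \<Rightarrow> scalar" where
  "w l x = (\<Sum>j\<in>spatial. k l j x * pd j u x)"

definition grad2 :: scalar where
  "grad2 x = (\<Sum>l\<in>spatial. pd l u x * w l x)"

definition hess :: "4 \<Rightarrow> 4 \<Rightarrow> scalar" where
  "hess i j x = pd j (pd i u) x - (\<Sum>l\<in>spatial. pd l u x * \<gamma> l j i x)"

definition lap :: scalar where
  "lap x = (\<Sum>l\<in>spatial. pd l (w l) x) + (\<Sum>r\<in>spatial. \<Sum>l\<in>spatial. \<gamma> r r l x * w l x)"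

text \<open>
  \<open>lap\<close> is written as the divergence of the gradient; \<open>trace_hess\<close> identifies it with the
  trace of \<open>hess\<close>.
\<close>

definition spatial_ricci :: "4 \<Rightarrow> 4 \<Rightarrow> scalar" where
  "spatial_ricci i j x = (\<Sum>l\<in>spatial. pd l (\<gamma> l j i) x) - (\<Sum>l\<in>spatial. pd j (\<gamma> l l i) x)
    + (\<Sum>r\<in>spatial. \<Sum>l\<in>spatial. \<gamma> r r l x * \<gamma> l j i x - \<gamma> r j l x * \<gamma> l r i x)"

section \<open>Regularity, staticity and metric compatibility of the spatial geometry\<close>

lemma h_diff: "x \<in> W \<Longrightarrow> i \<noteq> 0 \<Longrightarrow> j \<noteq> 0 \<Longrightarrow> h i j differentiable (at x)"
  and u_diff: "x \<in> W \<Longrightarrow> u differentiable (at x)"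
  and dh_diff: "x \<in> W \<Longrightarrow> i \<noteq> 0 \<Longrightarrow> j \<noteq> 0 \<Longrightarrow> pd l (h i j) differentiable (at x)"
  and du_diff: "x \<in> W \<Longrightarrow> pd l u differentiable (at x)"
  using smooth_on_differentiable[OF open_W] h_smooth u_smooth smooth_on_pd by blast+

text \<open>Staticity speaks of first derivatives. With \<open>pd 0\<close> innermost, the function
  differentiated vanishes on the open set \<open>W\<close>; the other order follows by
  \<open>pd_commute\<close>.\<close>

lemma h_static2: "x \<in> W \<Longrightarrow> i \<noteq> 0 \<Longrightarrow> j \<noteq> 0 \<Longrightarrow> pd 0 (pd l (h i j)) x = 0"
  and u_static2: "x \<in> W \<Longrightarrow> pd 0 (pd l u) x = 0" "x \<in> W \<Longrightarrow> pd l (pd 0 u) x = 0"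
proof -
  have const: "pd l f x = 0" if "\<And>y. y \<in> W \<Longrightarrow> f y = 0" "x \<in> W" for f x l
    using pd_cong[OF open_W that(2,1)] by simp
  show "pd 0 (pd l (h i j)) x = 0" if "x \<in> W" "i \<noteq> 0" "j \<noteq> 0"
    using pd_commute[OF open_W h_smooth, of i j x 0 l] that const[of "pd 0 (h i j)"] h_static by auto
  show "pd l (pd 0 u) x = 0" if "x \<in> W"
    using that const[of "pd 0 u"] u_static by auto
  then show "pd 0 (pd l u) x = 0" if "x \<in> W"
    using pd_commute[OF open_W u_smooth, of x 0 l] that by auto
qed

text \<open>Differentiating k h = 1 along eta gives (pd 0 k) h = 0; multiplication by
  \<open>k\<close> from the right finishes.\<close>

lemma k_static:
  assumes x: "x \<in> W" and ij: "i \<noteq> 0" "j \<noteq> 0"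
  shows "pd 0 (k i j) x = 0"
proof -
  have zero: "(\<Sum>l\<in>spatial. pd 0 (k i l) x * h l m x) = 0" if "m \<noteq> 0" for m
  proof -
    have "(\<Sum>l\<in>spatial. pd 0 (k i l) x * h l m x) = (\<Sum>l\<in>spatial. pd 0 (\<lambda>y. k i l y * h l m y) x)"
      using x ij that by (intro sum.cong) (auto simp: pd_mult k_diff h_diff h_static)
    also have "\<dots> = pd 0 (\<lambda>y. \<Sum>l\<in>spatial. k i l y * h l m y) x"
      using x ij that by (subst pd_sum) (auto intro!: differentiable_mult k_diff h_diff)
    also have "\<dots> = pd 0 (\<lambda>y. if i = m then 1 else 0) x"
      using x ij that kh by (intro pd_cong[OF open_W]) auto
    finally show ?thesis by simp
  qed
  have "pd 0 (k i j) x = (\<Sum>l\<in>spatial. pd 0 (k i l) x * (if l = j then 1 else 0))"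
    using ij by (simp add: if_distrib cong: if_cong)
  also have "\<dots> = (\<Sum>l\<in>spatial. pd 0 (k i l) x * (\<Sum>m\<in>spatial. h l m x * k m j x))"
    using x ij by (intro sum.cong) (auto simp: hk)
  also have "\<dots> = (\<Sum>m\<in>spatial. (\<Sum>l\<in>spatial. pd 0 (k i l) x * h l m x) * k m j x)"
    unfolding sum_distrib_left sum_distrib_right by (subst sum.swap) (simp add: mult.assoc)
  also have "\<dots> = 0" by (intro sum.neutral) (auto simp: zero)
  finally show ?thesis .
qed

lemma \<gamma>_diff: "x \<in> W \<Longrightarrow> l \<noteq> 0 \<Longrightarrow> i \<noteq> 0 \<Longrightarrow> j \<noteq> 0 \<Longrightarrow> \<gamma> l i j differentiable (at x)"
  unfolding \<gamma>_def[abs_def]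
  by (auto simp: field_simps intro!: differentiable_sum differentiable_mult differentiable_add
      differentiable_diff differentiable_divide k_diff dh_diff)

lemma w_diff: "x \<in> W \<Longrightarrow> l \<noteq> 0 \<Longrightarrow> w l differentiable (at x)"
  unfolding w_def[abs_def]
  by (auto intro!: differentiable_sum differentiable_mult k_diff du_diff)

lemma \<gamma>_static:
  assumes "x \<in> W" "l \<noteq> 0" "i \<noteq> 0" "j \<noteq> 0"
  shows "pd 0 (\<gamma> l i j) x = 0"
proof -
  have "pd 0 (\<gamma> l i j) x = (\<Sum>r\<in>spatial.
      pd 0 (\<lambda>x. (1 / 2) * (k l r x * (pd i (h r j) x + pd j (h r i) x - pd r (h i j) x))) x)"
    unfolding \<gamma>_def[abs_def] using assms
    by (subst pd_sum)
      (auto intro!: differentiable_divide differentiable_mult differentiable_add differentiable_diff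
        k_diff dh_diff sum.cong)
  also have "\<dots> = 0"
    using assms
    by (intro sum.neutral)
      (auto simp: pd_divide_const pd_mult pd_add pd_diff k_static h_static2 k_diff dh_diff)
  finally show ?thesis .
qed

lemma \<gamma>_sym:
  assumes "x \<in> W" "i \<noteq> 0" "j \<noteq> 0"
  shows "\<gamma> l i j x = \<gamma> l j i x"
proof -
  have "pd r (h i j) x = pd r (h j i) x" for r
    using assms h_sym by (intro pd_cong[OF open_W])
  then show ?thesis by (simp add: \<gamma>_def add.commute)
qed

lemma contract_hk:
  assumes "x \<in> W" "m \<noteq> 0"
  shows "(\<Sum>l\<in>spatial. h m l x * (\<Sum>r\<in>spatial. k l r x * A r)) = A m"
proof -
  have "(\<Sum>l\<in>spatial. h m l x * (\<Sum>r\<in>spatial. k l r x * A r))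
      = (\<Sum>r\<in>spatial. (\<Sum>l\<in>spatial. h m l x * k l r x) * A r)"
    unfolding sum_distrib_left sum_distrib_right by (subst sum.swap) (simp add: mult.assoc)
  also have "\<dots> = (\<Sum>r\<in>spatial. if m = r then A r else 0)"
    using assms by (intro sum.cong) (auto simp: hk)
  finally show ?thesis using assms by simp
qed

lemma h_w: "x \<in> W \<Longrightarrow> i \<noteq> 0 \<Longrightarrow> (\<Sum>j\<in>spatial. h i j x * w j x) = pd i u x"
  unfolding w_def by (rule contract_hk)

text \<open>Lowering the upper index gives the Christoffel symbols of the first kind, free of
  \<open>k\<close>.\<close>

lemma h_\<gamma>:
  assumes "x \<in> W" "m \<noteq> 0"
  shows "(\<Sum>l\<in>spatial. h m l x * \<gamma> l i j x) = (pd i (h m j) x + pd j (h m i) x - pd m (h i j) x) / 2"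
  using contract_hk[OF assms, of "\<lambda>r. (pd i (h r j) x + pd j (h r i) x - pd r (h i j) x) / 2"]
  by (simp add: \<gamma>_def)

text \<open>Metric compatibility of the Levi-Civita connection of \<open>h\<close>: in the sum of
  two symbols of the first kind all derivatives except the one in direction l cancel.\<close>

lemma pd_h:
  assumes "x \<in> W" "i \<noteq> 0" "j \<noteq> 0" "l \<noteq> 0"
  shows "pd l (h i j) x = (\<Sum>r\<in>spatial. h r i x * \<gamma> r l j x + h j r x * \<gamma> r l i x)"
proof -
  have "(\<Sum>r\<in>spatial. h r i x * \<gamma> r l j x + h j r x * \<gamma> r l i x)
     = (\<Sum>r\<in>spatial. h i r x * \<gamma> r l j x) + (\<Sum>r\<in>spatial. h j r x * \<gamma> r l i x)"
    unfolding sum.distrib using assms by (intro arg_cong2[where f = "(+)"] sum.cong) (auto simp: h_sym)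
  moreover have "pd a (h i j) x = pd a (h j i) x" "pd a (h i l) x = pd a (h l i) x"
    "pd a (h l j) x = pd a (h j l) x" for a
    using assms h_sym by (auto intro!: pd_cong[OF open_W])
  ultimately show ?thesis using assms by (simp add: h_\<gamma> field_simps)
qed

text \<open>
  The Christoffel symbols of the metrics in \<open>block_metric\<close> below, where \<open>m\<close> is the derivative of the
  conformal exponent \<open>\<mu>\<close>.
\<close>

definition conn :: "real \<Rightarrow> real \<Rightarrow> (real \<Rightarrow> real) \<Rightarrow> 4 \<Rightarrow> 4 \<Rightarrow> 4 \<Rightarrow> scalar" where
  "conn \<epsilon> b m l i j x =
    (if l = 0 then
       if i = 0 \<and> j = 0 then m (x $ 0)
       else if i = 0 then b / 2 * pd j u x
       else if j = 0 then b / 2 * pd i u x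
       else - \<epsilon> * m (x $ 0) * exp ((1 - 2 * b) * u x) * h i j x
     else
       if i = 0 \<and> j = 0 then - \<epsilon> * b / 2 * (exp ((2 * b - 1) * u x) * w l x)
       else if i = 0 then if l = j then m (x $ 0) else 0
       else if j = 0 then if l = i then m (x $ 0) else 0
       else \<gamma> l i j x + conformal_shift ((1 - b) / 2) (\<lambda>i. pd i u x) (\<lambda>l. w l x) (\<lambda>i j. h i j x) l i j)"

section \<open>Ricci tensor of the coefficients \<open>conn\<close> at a fixed point, and traces
  with the inverse spatial metric\<close>

context
  fixes x :: "real ^ 4"
  assumes x: "x \<in> W"
begin

lemmas diffs = h_diff[OF x] u_diff[OF x] dh_diff[OF x] du_diff[OF x] w_diff[OF x] \<gamma>_diff[OF x]

text \<open>The derivative of the identity h w = du. Keeping the products whole avoids expanding the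
  derivative of \<open>k\<close> hidden in \<open>w\<close>.\<close>

lemma pd_h_w:
  assumes "i \<noteq> 0"
  shows "(\<Sum>l\<in>spatial. pd j (\<lambda>y. h l i y * w l y) x) = pd j (pd i u) x"
proof -
  have "(\<Sum>l\<in>spatial. pd j (\<lambda>y. h l i y * w l y) x) = pd j (\<lambda>y. \<Sum>l\<in>spatial. h l i y * w l y) x"
    using assms by (subst pd_sum) (auto intro!: differentiable_mult diffs)
  also have "\<dots> = pd j (pd i u) x"
  proof (rule pd_cong[OF open_W x])
    fix y assume y: "y \<in> W"
    have "(\<Sum>l\<in>spatial. h l i y * w l y) = (\<Sum>l\<in>spatial. h i l y * w l y)"
      using y assms by (intro sum.cong) (auto simp: h_sym)
    then show "(\<Sum>l\<in>spatial. h l i y * w l y) = pd i u y"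
      using y assms by (simp add: h_w)
  qed
  finally show ?thesis .
qed

text \<open>The product of \<open>h\<close> and \<open>w\<close> stays unexpanded:
  \<open>pd_trace_conn\<close> resums it by \<open>pd_h_w\<close>, whereas \<open>div_conn\<close>
  needs the product rule.\<close>

lemma pd_shift:
  assumes "l \<noteq> 0" "i \<noteq> 0" "j \<noteq> 0"
  shows "pd r (\<lambda>y. conformal_shift a (\<lambda>i. pd i u y) (\<lambda>l. w l y) (\<lambda>i j. h i j y) l i j) x
    = a * ((if l = i then pd r (pd j u) x else 0) + (if l = j then pd r (pd i u) x else 0)
        - pd r (\<lambda>y. h i j y * w l y) x)"
  unfolding conformal_shift_def using assms
  by (cases "l = i"; cases "l = j") (simp_all add: pd_mult pd_add pd_diff pd_minus diffs algebra_simps)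

lemma shift_diff:
  assumes "l \<noteq> 0" "i \<noteq> 0" "j \<noteq> 0"
  shows "(\<lambda>y. conformal_shift a (\<lambda>i. pd i u y) (\<lambda>l. w l y) (\<lambda>i j. h i j y) l i j) differentiable (at x)"
  unfolding conformal_shift_def using assms
  by (cases "l = i"; cases "l = j") (simp_all add: diffs)

lemma pd_conn_spatial:
  assumes "l \<noteq> 0" "i \<noteq> 0" "j \<noteq> 0"
  shows "pd r (conn \<epsilon> b m l i j) x = pd r (\<gamma> l i j) x
    + (1 - b) / 2 * ((if l = i then pd r (pd j u) x else 0) + (if l = j then pd r (pd i u) x else 0)
        - pd r (\<lambda>y. h i j y * w l y) x)"
proof -
  have "conn \<epsilon> b m l i j = (\<lambda>y. \<gamma> l i j y
      + conformal_shift ((1 - b) / 2) (\<lambda>i. pd i u y) (\<lambda>l. w l y) (\<lambda>i j. h i j y) l i j)"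
    using assms by (simp add: conn_def fun_eq_iff)
  then show ?thesis
    using assms by (simp add: pd_add pd_shift shift_diff diffs)
qed

text \<open>The derivative of \<open>h\<close> along the gradient is left as it is, since in
  \<open>ricci_of_conn_spatial\<close> it cancels the metric compatibility term of
  \<open>quadratic_shift\<close>.\<close>

lemma div_conn:
  assumes "i \<noteq> 0" "j \<noteq> 0"
  shows "(\<Sum>l\<in>spatial. pd l (conn \<epsilon> b m l j i) x) = (\<Sum>l\<in>spatial. pd l (\<gamma> l j i) x)
    + (1 - b) / 2 * (2 * pd j (pd i u) x - (\<Sum>l\<in>spatial. pd l (h i j) x * w l x)
        - h i j x * (\<Sum>l\<in>spatial. pd l (w l) x))"
proof -
  have hij: "pd l (h j i) x = pd l (h i j) x" "h j i x = h i j x" for l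
    using assms h_sym x by (auto intro!: pd_cong[OF open_W])
  have "(\<Sum>l\<in>spatial. pd l (conn \<epsilon> b m l j i) x) = (\<Sum>l\<in>spatial. pd l (\<gamma> l j i) x
      + (1 - b) / 2 * ((if l = j then pd l (pd i u) x else 0) + (if l = i then pd l (pd j u) x else 0)
        - pd l (h i j) x * w l x - h i j x * pd l (w l) x))"
    using assms by (intro sum.cong) (auto simp: pd_conn_spatial pd_mult diffs hij)
  also have "\<dots> = (\<Sum>l\<in>spatial. pd l (\<gamma> l j i) x)
      + (1 - b) / 2 * ((\<Sum>l\<in>spatial. if l = j then pd l (pd i u) x else 0)
        + (\<Sum>l\<in>spatial. if l = i then pd l (pd j u) x else 0)
        - (\<Sum>l\<in>spatial. pd l (h i j) x * w l x) - h i j x * (\<Sum>l\<in>spatial. pd l (w l) x))"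
    by (simp only: sum.distrib sum_subtractf flip: sum_distrib_left)
  finally show ?thesis
    using assms pd_commute[OF open_W u_smooth x, of i j] by simp
qed

text \<open>Again 3 is the dimension: the second delta and the resummed h w term cancel.\<close>

lemma pd_trace_conn:
  assumes "i \<noteq> 0"
  shows "(\<Sum>l\<in>spatial. pd j (conn \<epsilon> b m l l i) x)
    = (\<Sum>l\<in>spatial. pd j (\<gamma> l l i) x) + (1 - b) / 2 * (3 * pd j (pd i u) x)"
proof -
  have "(\<Sum>l\<in>spatial. pd j (conn \<epsilon> b m l l i) x) = (\<Sum>l\<in>spatial. pd j (\<gamma> l l i) x
      + (1 - b) / 2 * (pd j (pd i u) x + (if l = i then pd j (pd i u) x else 0)
        - pd j (\<lambda>y. h l i y * w l y) x))"
    using assms by (intro sum.cong) (auto simp: pd_conn_spatial)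
  also have "\<dots> = (\<Sum>l\<in>spatial. pd j (\<gamma> l l i) x)
      + (1 - b) / 2 * ((\<Sum>l\<in>spatial. pd j (pd i u) x) + (\<Sum>l\<in>spatial. if l = i then pd j (pd i u) x else 0)
        - (\<Sum>l\<in>spatial. pd j (\<lambda>y. h l i y * w l y) x))"
    by (simp only: sum.distrib sum_subtractf flip: sum_distrib_left)
  finally show ?thesis using assms by (simp add: pd_h_w)
qed

lemma conn_trace_0: "(\<Sum>l\<in>spatial. conn \<epsilon> b m l l 0 x) = 3 * m (x $ 0)"
  by (simp add: conn_def)

lemma conn_trace:
  assumes "i \<noteq> 0"
  shows "(\<Sum>l\<in>spatial. conn \<epsilon> b m l l i x)
    = (\<Sum>l\<in>spatial. \<gamma> l l i x) + 3 * ((1 - b) / 2) * pd i u x"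
  using assms trace_shift[where h = "\<lambda>i j. h i j x" and w = "\<lambda>l. w l x" and u = "\<lambda>i. pd i u x" and j = i
      and a = "(1 - b) / 2"]
  by (simp add: conn_def sum.distrib h_sym h_w x)

lemma pd_time:
  assumes "(m has_field_derivative m') (at (x $ 0))"
  shows "pd i (\<lambda>y. m (y $ 0)) x = (if i = 0 then m' else 0)"
    and "(\<lambda>y. m (y $ 0)) differentiable (at x)"
  using pd_comp[OF nth_differentiable assms] differentiable_comp_real[OF nth_differentiable assms]
  by (simp_all add: pd_nth)

lemma pd_exp_u: "pd i (\<lambda>y. exp (c * u y)) x = c * exp (c * u x) * pd i u x"
  and exp_u_diff: "(\<lambda>y. exp (c * u y)) differentiable (at x)"
proof -
  have d: "((\<lambda>s. exp (c * s)) has_field_derivative c * exp (c * u x)) (at (u x))"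
    by (auto intro!: derivative_eq_intros)
  show "pd i (\<lambda>y. exp (c * u y)) x = c * exp (c * u x) * pd i u x"
    "(\<lambda>y. exp (c * u y)) differentiable (at x)"
    using pd_comp[OF u_diff[OF x] d] differentiable_comp_real[OF u_diff[OF x] d] by simp_all
qed

text \<open>Here the weights of the two blocks combine. Hess(u) gets - b/2 from the coefficients
  with upper index 0 (facts 2 and 3) and - (1 - b)/2 from the conformal change, in total - 1/2. In
  the bracket, grad2 gets b/2 + (1 - b)/2 = 1/2. The u_i u_j terms are - b^2/4 (fact 7), b (1 - b)/2
  (fact 3) and (1 - b)^2/4 (fact 6).\<close>

lemma ricci_of_conn_spatial:
  assumes m: "(m has_field_derivative m') (at (x $ 0))" and ij: "i \<noteq> 0" "j \<noteq> 0"
  shows "ricci_of (conn \<epsilon> b m) i j x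
    = spatial_ricci i j x - hess i j x / 2
      - (1 - b) / 2 * h i j x * (lap x + grad2 x / 2)
      + (1 / 4 - b\<^sup>2 / 2) * pd i u x * pd j u x
      - \<epsilon> * exp ((1 - 2 * b) * u x) * h i j x * (m' + 2 * (m (x $ 0))\<^sup>2)"
proof -
  let ?a = "(1 - b) / 2" and ?E = "exp ((1 - 2 * b) * u x)" and ?m = "m (x $ 0)"
  let ?C = "conn \<epsilon> b m"
  have hji: "h j i x = h i j x" using h_sym x ij by simp
  have 1: "pd 0 (?C 0 j i) x = - \<epsilon> * m' * ?E * h i j x"
  proof -
    have "?C 0 j i = (\<lambda>y. - \<epsilon> * m (y $ 0) * exp ((1 - 2 * b) * u y) * h j i y)"
      using ij by (simp add: conn_def fun_eq_iff)
    then show ?thesis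
      using ij
      by (simp add: pd_mult pd_minus pd_time[OF m] pd_exp_u exp_u_diff h_static u_static x diffs hji)
  qed
  have 2: "pd j (?C 0 0 i) x = b / 2 * pd j (pd i u) x"
  proof -
    have "?C 0 0 i = (\<lambda>y. b / 2 * pd i u y)"
      using ij by (simp add: conn_def fun_eq_iff)
    then show ?thesis
      using pd_mult[of "\<lambda>y. b / 2" x "pd i u" j] by (simp add: diffs)
  qed
  have 3: "(\<Sum>l\<in>spatial. ?C 0 0 l x * ?C l j i x)
      = b / 2 * ((\<Sum>l\<in>spatial. pd l u x * \<gamma> l j i x)
          + ?a * (2 * pd i u x * pd j u x - h i j x * grad2 x))"
  proof -
    have "(\<Sum>l\<in>spatial. ?C 0 0 l x * ?C l j i x)
        = (\<Sum>l\<in>spatial. b / 2 * (pd l u x * \<gamma> l j i x + pd l u x *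
            conformal_shift ?a (\<lambda>i. pd i u x) (\<lambda>l. w l x) (\<lambda>i j. h i j x) l j i))"
      using ij by (intro sum.cong) (auto simp: conn_def algebra_simps)
    also have "\<dots> = b / 2 * ((\<Sum>l\<in>spatial. pd l u x * \<gamma> l j i x) + (\<Sum>l\<in>spatial. pd l u x *
            conformal_shift ?a (\<lambda>i. pd i u x) (\<lambda>l. w l x) (\<lambda>i j. h i j x) l j i))"
      by (simp only: sum.distrib flip: sum_distrib_left)
    also have "(\<Sum>l\<in>spatial. pd l u x *
            conformal_shift ?a (\<lambda>i. pd i u x) (\<lambda>l. w l x) (\<lambda>i j. h i j x) l j i)
        = ?a * (2 * pd i u x * pd j u x - h i j x * grad2 x)"
      using ij by (subst contract_shift) (auto simp: h_sym h_w x grad2_def)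
    finally show ?thesis .
  qed
  have 4: "(\<Sum>l\<in>spatial. ?C 0 j l x * ?C l 0 i x) = - \<epsilon> * ?m\<^sup>2 * ?E * h i j x"
  proof -
    have "(\<Sum>l\<in>spatial. ?C 0 j l x * ?C l 0 i x)
        = (\<Sum>l\<in>spatial. if l = i then - \<epsilon> * ?m\<^sup>2 * ?E * h i j x else 0)"
      using ij by (intro sum.cong) (auto simp: conn_def power2_eq_square hji)
    then show ?thesis using ij by simp
  qed
  have 5: "(\<Sum>r\<in>spatial. ?C r j 0 x * ?C 0 r i x) = - \<epsilon> * ?m\<^sup>2 * ?E * h i j x"
  proof -
    have "(\<Sum>r\<in>spatial. ?C r j 0 x * ?C 0 r i x)
        = (\<Sum>r\<in>spatial. if r = j then - \<epsilon> * ?m\<^sup>2 * ?E * h i j x else 0)"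
      using ij by (intro sum.cong) (auto simp: conn_def power2_eq_square hji)
    then show ?thesis using ij by simp
  qed
  have 6: "(\<Sum>r\<in>spatial. \<Sum>l\<in>spatial. ?C r r l x * ?C l j i x - ?C r j l x * ?C l r i x)
      = (\<Sum>r\<in>spatial. \<Sum>l\<in>spatial. \<gamma> r r l x * \<gamma> l j i x - \<gamma> r j l x * \<gamma> l r i x)
        + ?a * ((\<Sum>l\<in>spatial. pd l u x * \<gamma> l j i x)
          - h i j x * (\<Sum>r\<in>spatial. \<Sum>l\<in>spatial. \<gamma> r r l x * w l x)
          + (\<Sum>l\<in>spatial. pd l (h i j) x * w l x))
        + ?a\<^sup>2 * (pd i u x * pd j u x - h i j x * grad2 x)"
  proof -
    \<comment> \<open>Compatibility identifies the last linear term of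
      \<open>quadratic_shift\<close> with the derivative of \<open>h\<close> along the
      gradient.\<close>
    have eq: "(\<Sum>l\<in>spatial. pd l (h i j) x * w l x)
        = (\<Sum>l\<in>spatial. w l x * (\<Sum>r\<in>spatial. h r i x * \<gamma> r l j x + h j r x * \<gamma> r l i x))"
      using ij by (intro sum.cong) (auto simp: pd_h x)
    let ?S = "conformal_shift ?a (\<lambda>i. pd i u x) (\<lambda>l. w l x) (\<lambda>i j. h i j x)"
    have "(\<Sum>r\<in>spatial. \<Sum>l\<in>spatial. ?C r r l x * ?C l j i x - ?C r j l x * ?C l r i x)
      = (\<Sum>r\<in>spatial. \<Sum>l\<in>spatial. (\<gamma> r r l x + ?S r r l) * (\<gamma> l j i x + ?S l j i)
          - (\<gamma> r j l x + ?S r j l) * (\<gamma> l r i x + ?S l r i))"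
      using ij by (intro sum.cong) (auto simp: conn_def)
    also note quadratic_shift[where h = "\<lambda>i j. h i j x" and w = "\<lambda>l. w l x" and u = "\<lambda>i. pd i u x"
        and \<gamma> = "\<lambda>l i j. \<gamma> l i j x" and i = i and j = j and a = ?a]
    finally show ?thesis
      using ij by (simp add: eq h_sym h_w x \<gamma>_sym grad2_def)
  qed
  have 7: "?C 0 0 0 x * ?C 0 j i x - ?C 0 j 0 x * ?C 0 0 i x
      = - \<epsilon> * ?m\<^sup>2 * ?E * h i j x - b\<^sup>2 / 4 * pd i u x * pd j u x"
    using ij by (simp add: conn_def power2_eq_square hji)
  have 8: "(\<Sum>r\<in>spatial. ?C r r 0 x) * ?C 0 j i x = - 3 * \<epsilon> * ?m\<^sup>2 * ?E * h i j x"
    unfolding conn_trace_0 using ij by (simp add: conn_def power2_eq_square hji)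
  show ?thesis
    unfolding ricci_of_split 1 2 3 4 5 6 7 8 div_conn[OF ij] pd_trace_conn[OF ij(1)]
      spatial_ricci_def hess_def lap_def
    by (simp add: field_simps power2_eq_square)
qed

text \<open>The coefficient of grad2 collects 2 b - 1 from differentiating the exponential, - b/2
  net from the products in fact 5, and 3 (1 - b)/2 from the spatial trace: 1/2 for every
  \<open>b\<close>. The squares of \<open>m\<close> in facts 6 and 7 cancel.\<close>

lemma ricci_of_conn_time:
  assumes m: "(m has_field_derivative m') (at (x $ 0))"
  shows "ricci_of (conn \<epsilon> b m) 0 0 x
    = - 3 * m' - \<epsilon> * b / 2 * exp ((2 * b - 1) * u x) * (lap x + grad2 x / 2)"
proof -
  let ?E = "exp ((2 * b - 1) * u x)" and ?m = "m (x $ 0)"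
  let ?C = "conn \<epsilon> b m"
  have C0l: "?C l 0 0 = (\<lambda>y. - \<epsilon> * b / 2 * (exp ((2 * b - 1) * u y) * w l y))" if "l \<noteq> 0" for l
    using that by (simp add: conn_def fun_eq_iff)
  have 1: "pd 0 (?C 0 0 0) x = m'"
    using pd_time(1)[OF m, of 0] by (simp add: conn_def[abs_def])
  have 2: "(\<Sum>l\<in>spatial. pd l (?C l 0 0) x)
      = - \<epsilon> * b / 2 * ?E * ((2 * b - 1) * grad2 x + (\<Sum>l\<in>spatial. pd l (w l) x))"
  proof -
    have "(\<Sum>l\<in>spatial. pd l (?C l 0 0) x)
        = (\<Sum>l\<in>spatial. - \<epsilon> * b / 2 * ?E * ((2 * b - 1) * (pd l u x * w l x) + pd l (w l) x))"
    proof (intro sum.cong refl)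
      fix l assume l: "l \<in> spatial"
      have "pd l (?C l 0 0) x = - \<epsilon> * b / 2 * pd l (\<lambda>y. exp ((2 * b - 1) * u y) * w l y) x"
        using l pd_mult[of "\<lambda>y. - \<epsilon> * b / 2" x "\<lambda>y. exp ((2 * b - 1) * u y) * w l y" l]
        by (simp add: C0l exp_u_diff diffs)
      also have "pd l (\<lambda>y. exp ((2 * b - 1) * u y) * w l y) x
          = ?E * ((2 * b - 1) * (pd l u x * w l x) + pd l (w l) x)"
      proof -
        have "pd l (\<lambda>y. exp ((2 * b - 1) * u y) * w l y) x
            = pd l (\<lambda>y. exp ((2 * b - 1) * u y)) x * w l x + ?E * pd l (w l) x"
          using l by (intro pd_mult exp_u_diff diffs) simp
        then show ?thesis unfolding pd_exp_u by (simp add: algebra_simps)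
      qed
      finally show "pd l (?C l 0 0) x
          = - \<epsilon> * b / 2 * ?E * ((2 * b - 1) * (pd l u x * w l x) + pd l (w l) x)"
        by simp
    qed
    then show ?thesis
      by (simp only: sum.distrib grad2_def flip: sum_distrib_left)
  qed
  have 3: "(\<Sum>l\<in>spatial. pd 0 (?C l l 0) x) = 3 * m'"
    using pd_time(1)[OF m, of 0] by (simp add: conn_def[abs_def])
  have 4: "?C 0 0 0 x * ?C 0 0 0 x - ?C 0 0 0 x * ?C 0 0 0 x = 0" by simp
  have C: "?C 0 0 l x = b / 2 * pd l u x" "?C 0 l 0 x = b / 2 * pd l u x"
    "?C l 0 0 x = - \<epsilon> * b / 2 * ?E * w l x" if "l \<noteq> 0" for l
    using that by (simp_all add: conn_def)
  have 5: "(\<Sum>l\<in>spatial. ?C 0 0 l x * ?C l 0 0 x) = - \<epsilon> * b / 2 * ?E * (b / 2 * grad2 x)"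
    "(\<Sum>l\<in>spatial. ?C l 0 0 x * ?C 0 l 0 x) = - \<epsilon> * b / 2 * ?E * (b / 2 * grad2 x)"
    unfolding grad2_def sum_distrib_left by (auto intro!: sum.cong simp: C)
  have 6: "(\<Sum>r\<in>spatial. ?C r r 0 x) * ?C 0 0 0 x = 3 * ?m\<^sup>2"
    unfolding conn_trace_0 by (simp add: conn_def power2_eq_square)
  have 7: "(\<Sum>r\<in>spatial. \<Sum>l\<in>spatial. ?C r r l x * ?C l 0 0 x - ?C r 0 l x * ?C l r 0 x)
      = - \<epsilon> * b / 2 * ?E * ((\<Sum>r\<in>spatial. \<Sum>l\<in>spatial. \<gamma> r r l x * w l x)
          + 3 * ((1 - b) / 2) * grad2 x) - 3 * ?m\<^sup>2"
  proof -
    have "(\<Sum>r\<in>spatial. \<Sum>l\<in>spatial. ?C r r l x * ?C l 0 0 x)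
        = (\<Sum>l\<in>spatial. (\<Sum>r\<in>spatial. ?C r r l x) * ?C l 0 0 x)"
      by (subst sum.swap) (simp only: sum_distrib_right)
    also have "\<dots> = (\<Sum>l\<in>spatial. - \<epsilon> * b / 2 * ?E *
        ((\<Sum>r\<in>spatial. \<gamma> r r l x * w l x) + 3 * ((1 - b) / 2) * (pd l u x * w l x)))"
    proof (intro sum.cong refl)
      fix l assume "l \<in> spatial"
      then have l: "l \<noteq> 0" by simp
      show "(\<Sum>r\<in>spatial. ?C r r l x) * ?C l 0 0 x = - \<epsilon> * b / 2 * ?E *
          ((\<Sum>r\<in>spatial. \<gamma> r r l x * w l x) + 3 * ((1 - b) / 2) * (pd l u x * w l x))"
        unfolding conn_trace[OF l] C[OF l] sum_distrib_right[symmetric] by (simp add: field_simps)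
    qed
    also have "\<dots> = - \<epsilon> * b / 2 * ?E * ((\<Sum>l\<in>spatial. \<Sum>r\<in>spatial. \<gamma> r r l x * w l x)
        + 3 * ((1 - b) / 2) * grad2 x)"
      by (simp only: sum.distrib grad2_def flip: sum_distrib_left)
    also have "(\<Sum>l\<in>spatial. \<Sum>r\<in>spatial. \<gamma> r r l x * w l x)
        = (\<Sum>r\<in>spatial. \<Sum>l\<in>spatial. \<gamma> r r l x * w l x)"
      by (rule sum.swap)
    finally have a: "(\<Sum>r\<in>spatial. \<Sum>l\<in>spatial. ?C r r l x * ?C l 0 0 x)
        = - \<epsilon> * b / 2 * ?E * ((\<Sum>r\<in>spatial. \<Sum>l\<in>spatial. \<gamma> r r l x * w l x)
          + 3 * ((1 - b) / 2) * grad2 x)" .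
    have "(\<Sum>r\<in>spatial. \<Sum>l\<in>spatial. ?C r 0 l x * ?C l r 0 x)
        = (\<Sum>r\<in>spatial. \<Sum>l\<in>spatial. if l = r then ?m\<^sup>2 else 0)"
      by (intro sum.cong) (auto simp: conn_def power2_eq_square)
    also have "\<dots> = 3 * ?m\<^sup>2" by simp
    finally show ?thesis
      unfolding sum_subtractf a by simp
  qed
  show ?thesis
    unfolding ricci_of_split 1 2 3 4 5 6 7 lap_def by (simp add: field_simps power2_eq_square)
qed

text \<open>Both orders are computed, because \<open>ricci_of\<close> is not symmetric for general
  coefficients. In each order the derivative terms vanish and the surviving products contribute b/2
  times 1 - 1 + 3 - 1, the 3 being the spatial trace. One product carries \<epsilon> twice together
  with two reciprocal exponentials, hence the condition on \<epsilon>.\<close>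

lemma ricci_of_conn_mixed:
  assumes m: "(m has_field_derivative m') (at (x $ 0))" and j: "j \<noteq> 0" and \<epsilon>: "\<epsilon>\<^sup>2 = 1"
  shows "ricci_of (conn \<epsilon> b m) 0 j x = b * m (x $ 0) * pd j u x"
    and "ricci_of (conn \<epsilon> b m) j 0 x = b * m (x $ 0) * pd j u x"
proof -
  let ?m = "m (x $ 0)"
  let ?C = "conn \<epsilon> b m"
  have C0: "?C 0 0 0 = (\<lambda>y. m (y $ 0))" "?C 0 0 j = (\<lambda>y. b / 2 * pd j u y)" "?C 0 j 0 = (\<lambda>y. b / 2 * pd j u y)"
    "?C l j 0 = (\<lambda>y. if l = j then m (y $ 0) else 0)" "?C l 0 j = (\<lambda>y. if l = j then m (y $ 0) else 0)"
    "?C l l 0 = (\<lambda>y. m (y $ 0))" "?C l 0 l = (\<lambda>y. m (y $ 0))"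
    if "l \<noteq> 0" for l
    using j that by (simp_all add: conn_def fun_eq_iff)
  have time: "pd 0 (?C 0 0 j) x = 0" "pd 0 (?C 0 j 0) x = 0"
    "pd j (?C 0 0 0) x = 0"
    using C0[OF j] pd_mult[of "\<lambda>y. b / 2" x "pd j u" 0] j
    by (simp_all add: diffs u_static2 x pd_time[OF m])
  have space: "(\<Sum>l\<in>spatial. pd l (?C l j 0) x) = 0" "(\<Sum>l\<in>spatial. pd l (?C l 0 j) x) = 0"
    "(\<Sum>l\<in>spatial. pd j (?C l l 0) x) = 0"
  proof -
    have *: "pd l (\<lambda>y. if l = j then m (y $ 0) else 0) x = 0" if "l \<noteq> 0" for l
      using that by (cases "l = j") (simp_all add: pd_time[OF m])
    show "(\<Sum>l\<in>spatial. pd l (?C l j 0) x) = 0" "(\<Sum>l\<in>spatial. pd l (?C l 0 j) x) = 0"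
      "(\<Sum>l\<in>spatial. pd j (?C l l 0) x) = 0"
      using j by (auto intro!: sum.neutral simp: C0 pd_time[OF m] *)
  qed
  \<comment> \<open>Only the order j, 0 differentiates the full spatial trace along eta; this is
    where staticity of \<gamma>, \<open>k\<close> and \<open>w\<close> enters.\<close>
  have space': "(\<Sum>l\<in>spatial. pd 0 (?C l l j) x) = 0"
  proof -
    have "pd 0 (?C l l j) x = 0" if "l \<noteq> 0" for l
    proof -
      have "pd 0 (w l) x = 0"
      proof -
        have "pd 0 (w l) x = (\<Sum>r\<in>spatial. pd 0 (\<lambda>x. k l r x * pd r u x) x)"
          unfolding w_def[abs_def] using that by (subst pd_sum) (auto intro!: differentiable_mult k_diff du_diff x)
        also have "\<dots> = 0"
          using that by (intro sum.neutral) (auto simp: pd_mult k_diff du_diff x k_static u_static2)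
        finally show ?thesis .
      qed
      then show ?thesis
        using that j by (simp add: pd_conn_spatial \<gamma>_static x u_static2 pd_mult diffs h_static)
    qed
    then show ?thesis by (auto intro!: sum.neutral)
  qed
  have CS: "(\<Sum>l\<in>spatial. ?C 0 j l x * ?C l 0 0 x) = \<epsilon>\<^sup>2 * (?m * b / 2 * pd j u x)"
    "(\<Sum>l\<in>spatial. ?C l 0 0 x * ?C 0 l j x) = \<epsilon>\<^sup>2 * (?m * b / 2 * pd j u x)"
  proof -
    have e: "exp ((1 - 2 * b) * u x) * exp ((2 * b - 1) * u x) = 1"
      by (simp flip: exp_add add: algebra_simps)
    have "(\<Sum>l\<in>spatial. ?C 0 j l x * ?C l 0 0 x)
        = (\<Sum>l\<in>spatial. (exp ((1 - 2 * b) * u x) * exp ((2 * b - 1) * u x)) * (\<epsilon>\<^sup>2 * ?m * b / 2) * (h j l x * w l x))"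
      using j by (intro sum.cong) (auto simp: conn_def power2_eq_square)
    also have "\<dots> = \<epsilon>\<^sup>2 * ?m * b / 2 * pd j u x"
      unfolding e mult_1_left h_w[OF x j, symmetric] by (simp only: sum_distrib_left)
    finally show 1: "(\<Sum>l\<in>spatial. ?C 0 j l x * ?C l 0 0 x) = \<epsilon>\<^sup>2 * (?m * b / 2 * pd j u x)" by simp
    have "(\<Sum>l\<in>spatial. ?C l 0 0 x * ?C 0 l j x) = (\<Sum>l\<in>spatial. ?C 0 j l x * ?C l 0 0 x)"
      using j by (intro sum.cong) (auto simp: conn_def h_sym x)
    with 1 show "(\<Sum>l\<in>spatial. ?C l 0 0 x * ?C 0 l j x) = \<epsilon>\<^sup>2 * (?m * b / 2 * pd j u x)" by simp
  qed
  have tr: "(\<Sum>r\<in>spatial. ?C r r 0 x) = 3 * ?m" by (rule conn_trace_0)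
  let ?T = "(\<Sum>l\<in>spatial. \<gamma> l l j x) + 3 * ((1 - b) / 2) * pd j u x"
  have A: "(\<Sum>l\<in>spatial. ?C 0 0 l x * ?C l j 0 x) = b / 2 * pd j u x * ?m"
    "(\<Sum>l\<in>spatial. ?C 0 0 l x * ?C l 0 j x) = b / 2 * pd j u x * ?m"
    "(\<Sum>r\<in>spatial. ?C r j 0 x * ?C 0 r 0 x) = b / 2 * pd j u x * ?m"
    using j by (simp_all add: conn_def if_distrib if_distribR cong: if_cong)
  \<comment> \<open>Coefficients with one lower index 0 and the others spatial are \<open>m\<close>
    times the identity, so all four double sums reduce to the same trace \<open>?T\<close> times
    \<open>m\<close>.\<close>
  have B: "(\<Sum>r\<in>spatial. \<Sum>l\<in>spatial. ?C r r l x * ?C l j 0 x - ?C r j l x * ?C l r 0 x) = 0"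
    "(\<Sum>r\<in>spatial. \<Sum>l\<in>spatial. ?C r r l x * ?C l 0 j x - ?C r 0 l x * ?C l r j x) = 0"
  proof -
    have "(\<Sum>r\<in>spatial. \<Sum>l\<in>spatial. ?C r j l x * ?C l r 0 x) = ?T * ?m"
    proof -
      have "(\<Sum>r\<in>spatial. \<Sum>l\<in>spatial. ?C r j l x * ?C l r 0 x) = (\<Sum>r\<in>spatial. ?C r j r x * ?m)"
      proof (intro sum.cong refl)
        fix r assume r: "r \<in> spatial"
        have "(\<Sum>l\<in>spatial. ?C r j l x * ?C l r 0 x)
            = (\<Sum>l\<in>spatial. if l = r then ?C r j r x * ?m else 0)"
          using r by (intro sum.cong) (auto simp: conn_def)
        then show "(\<Sum>l\<in>spatial. ?C r j l x * ?C l r 0 x) = ?C r j r x * ?m"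
          using r by simp
      qed
      also have "\<dots> = (\<Sum>r\<in>spatial. ?C r r j x * ?m)"
        using j by (intro sum.cong) (auto simp: conn_def \<gamma>_sym x conformal_shift_def h_sym)
      finally show ?thesis by (simp only: conn_trace[OF j] flip: sum_distrib_right)
    qed
    moreover have "(\<Sum>r\<in>spatial. \<Sum>l\<in>spatial. ?C r 0 l x * ?C l r j x) = ?T * ?m"
    proof -
      have "(\<Sum>r\<in>spatial. \<Sum>l\<in>spatial. ?C r 0 l x * ?C l r j x) = (\<Sum>r\<in>spatial. ?C r r j x * ?m)"
      proof (intro sum.cong refl)
        fix r assume r: "r \<in> spatial"
        have "(\<Sum>l\<in>spatial. ?C r 0 l x * ?C l r j x)
            = (\<Sum>l\<in>spatial. if l = r then ?C r r j x * ?m else 0)"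
          using r by (intro sum.cong) (auto simp: conn_def)
        then show "(\<Sum>l\<in>spatial. ?C r 0 l x * ?C l r j x) = ?C r r j x * ?m"
          using r by simp
      qed
      then show ?thesis by (simp only: conn_trace[OF j] flip: sum_distrib_right)
    qed
    moreover have "(\<Sum>r\<in>spatial. \<Sum>l\<in>spatial. ?C r r l x * ?C l 0 j x) = ?T * ?m"
      "(\<Sum>r\<in>spatial. \<Sum>l\<in>spatial. ?C r r l x * ?C l j 0 x) = ?T * ?m"
    proof -
      have *: "(\<Sum>r\<in>spatial. \<Sum>l\<in>spatial. ?C r r l x * (if l = j then ?m else 0)) = ?T * ?m"
        using j by (simp add: if_distrib cong: if_cong) (simp add: conn_trace flip: sum_distrib_right)
      show "(\<Sum>r\<in>spatial. \<Sum>l\<in>spatial. ?C r r l x * ?C l 0 j x) = ?T * ?m"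
        "(\<Sum>r\<in>spatial. \<Sum>l\<in>spatial. ?C r r l x * ?C l j 0 x) = ?T * ?m"
        unfolding *[symmetric] using j by (auto intro!: sum.cong simp: C0)
    qed
    ultimately show
      "(\<Sum>r\<in>spatial. \<Sum>l\<in>spatial. ?C r r l x * ?C l j 0 x - ?C r j l x * ?C l r 0 x) = 0"
      "(\<Sum>r\<in>spatial. \<Sum>l\<in>spatial. ?C r r l x * ?C l 0 j x - ?C r 0 l x * ?C l r j x) = 0"
      unfolding sum_subtractf by simp_all
  qed
  show "ricci_of ?C 0 j x = b * ?m * pd j u x"
    unfolding ricci_of_split time space CS A tr B
    using C0[OF j] \<epsilon> by (simp add: algebra_simps)
  show "ricci_of ?C j 0 x = b * ?m * pd j u x"
    unfolding ricci_of_split time space space' CS A tr B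
    using C0[OF j] \<epsilon> by (simp add: algebra_simps)
qed

text \<open>By compatibility \<open>hess i j\<close> is h_il times the covariant derivative of w^l
  in direction j: of the two \<gamma> terms produced by \<open>pd_h\<close>, one cancels the
  \<gamma> term of the Hessian. Contracting with \<open>k\<close> removes \<open>h\<close> and
  leaves the divergence.\<close>

lemma trace_hess: "(\<Sum>j\<in>spatial. \<Sum>i\<in>spatial. k j i x * hess i j x) = lap x"
proof -
  let ?N = "spatial"
  have kh_contract: "(\<Sum>i\<in>?N. k j i x * (\<Sum>l\<in>?N. h i l x * A l)) = A j" if "j \<noteq> 0" for j A
  proof -
    have "(\<Sum>i\<in>?N. k j i x * (\<Sum>l\<in>?N. h i l x * A l)) = (\<Sum>l\<in>?N. (\<Sum>i\<in>?N. k j i x * h i l x) * A l)"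
      unfolding sum_distrib_left sum_distrib_right by (subst sum.swap) (simp add: mult.assoc)
    also have "\<dots> = (\<Sum>l\<in>?N. if j = l then A l else 0)"
      using that by (intro sum.cong) (auto simp: kh x)
    finally show ?thesis using that by simp
  qed
  have hess: "hess i j x = (\<Sum>l\<in>?N. h i l x * pd j (w l) x) + (\<Sum>l\<in>?N. h i l x * (\<Sum>r\<in>?N. \<gamma> l j r x * w r x))"
    if "i \<noteq> 0" "j \<noteq> 0" for i j
  proof -
    have "pd j (pd i u) x = (\<Sum>l\<in>?N. pd j (\<lambda>y. h l i y * w l y) x)"
      using that pd_h_w by simp
    also have "\<dots> = (\<Sum>l\<in>?N. pd j (h l i) x * w l x + h i l x * pd j (w l) x)"
      using that by (intro sum.cong) (auto simp: pd_mult diffs h_sym x)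
    also have "\<dots> = (\<Sum>l\<in>?N. (\<Sum>r\<in>?N. h r l x * \<gamma> r j i x + h i r x * \<gamma> r j l x) * w l x)
        + (\<Sum>l\<in>?N. h i l x * pd j (w l) x)"
      unfolding sum.distrib[symmetric] using that by (intro sum.cong) (auto simp: pd_h x sum.distrib)
    also have "(\<Sum>l\<in>?N. (\<Sum>r\<in>?N. h r l x * \<gamma> r j i x + h i r x * \<gamma> r j l x) * w l x)
        = (\<Sum>l\<in>?N. \<Sum>r\<in>?N. (h r l x * w l x) * \<gamma> r j i x) + (\<Sum>l\<in>?N. \<Sum>r\<in>?N. h i r x * (\<gamma> r j l x * w l x))"
      unfolding sum.distrib[symmetric] sum_distrib_right by (intro sum.cong refl) (simp add: algebra_simps)
    also have "(\<Sum>l\<in>?N. \<Sum>r\<in>?N. (h r l x * w l x) * \<gamma> r j i x) = (\<Sum>r\<in>?N. (\<Sum>l\<in>?N. h r l x * w l x) * \<gamma> r j i x)"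
      by (subst sum.swap) (simp only: sum_distrib_right)
    also have "\<dots> = (\<Sum>r\<in>?N. pd r u x * \<gamma> r j i x)"
      by (intro sum.cong) (auto simp: h_w x)
    also have "(\<Sum>l\<in>?N. \<Sum>r\<in>?N. h i r x * (\<gamma> r j l x * w l x)) = (\<Sum>l\<in>?N. h i l x * (\<Sum>r\<in>?N. \<gamma> l j r x * w r x))"
      by (subst sum.swap) (simp only: sum_distrib_left)
    finally show ?thesis by (simp add: hess_def)
  qed
  have "(\<Sum>j\<in>?N. \<Sum>i\<in>?N. k j i x * hess i j x)
      = (\<Sum>j\<in>?N. (\<Sum>i\<in>?N. k j i x * (\<Sum>l\<in>?N. h i l x * pd j (w l) x))
          + (\<Sum>i\<in>?N. k j i x * (\<Sum>l\<in>?N. h i l x * (\<Sum>r\<in>?N. \<gamma> l j r x * w r x))))"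
    unfolding sum.distrib[symmetric] by (intro sum.cong refl) (simp add: hess ring_distribs)
  also have "\<dots> = (\<Sum>j\<in>?N. pd j (w j) x + (\<Sum>r\<in>?N. \<gamma> j j r x * w r x))"
    by (intro sum.cong refl arg_cong2[where f = "(+)"] kh_contract) simp_all
  finally show ?thesis by (simp add: sum.distrib lap_def)
qed

lemma trace_kh: "(\<Sum>j\<in>spatial. \<Sum>i\<in>spatial. k j i x * h i j x) = 3"
proof -
  have "(\<Sum>j\<in>spatial. \<Sum>i\<in>spatial. k j i x * h i j x) = (\<Sum>j\<in>spatial. 1)"
    by (intro sum.cong refl) (simp add: kh x)
  then show ?thesis by simp
qed

lemma trace_uu: "(\<Sum>j\<in>spatial. \<Sum>i\<in>spatial. k j i x * (pd i u x * pd j u x)) = grad2 x"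
  unfolding grad2_def w_def sum_distrib_left by (intro sum.cong refl) (simp add: mult_ac)

end

end

section \<open>Matrix inverses and the Christoffel symbols of the block metrics\<close>

lemma matrix_inv:
  fixes A :: "real ^ 'n ^ 'n"
  assumes "invertible A"
  shows "matrix_inv A ** A = mat 1" and "A ** matrix_inv A = mat 1"
  using assms someI_ex[of "\<lambda>B. A ** B = mat 1 \<and> B ** A = mat 1"]
  unfolding invertible_def matrix_inv_def by auto

lemma matrix_inv_unique:
  fixes A B :: "real ^ 'n ^ 'n"
  assumes "A ** B = mat 1"
  shows "matrix_inv A = B"
proof -
  have BA: "B ** A = mat 1" using assms matrix_left_right_inverse by blast
  then have inv: "invertible A" using assms by (auto simp: invertible_def)
  have "matrix_inv A = (B ** A) ** matrix_inv A" by (simp add: BA)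
  also have "\<dots> = B" by (simp add: matrix_mul_assoc[symmetric] matrix_inv[OF inv])
  finally show ?thesis .
qed

text \<open>To be interpreted twice over the same \<open>h\<close>, \<open>k\<close> and
  \<open>u\<close>. Writing both blocks as exponentials reduces the conformal factors to addition of
  exponents, and |g_00| to its logarithm \<open>u\<close>.\<close>

locale block_metric = spatial_metric +
  fixes M :: metric and \<epsilon> b :: real and \<mu> m :: "real \<Rightarrow> real"
  assumes \<epsilon>_sq: "\<epsilon>\<^sup>2 = 1"
    and M_00: "y \<in> W \<Longrightarrow> M y $ 0 $ 0 = \<epsilon> * exp (2 * \<mu> (y $ 0) + b * u y)"
    and M_0i: "y \<in> W \<Longrightarrow> i \<noteq> 0 \<Longrightarrow> M y $ 0 $ i = 0"
    and M_i0: "y \<in> W \<Longrightarrow> i \<noteq> 0 \<Longrightarrow> M y $ i $ 0 = 0"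
    and M_ij: "y \<in> W \<Longrightarrow> i \<noteq> 0 \<Longrightarrow> j \<noteq> 0 \<Longrightarrow>
      M y $ i $ j = exp (2 * \<mu> (y $ 0) + (1 - b) * u y) * h i j y"
    and \<mu>_deriv: "y \<in> W \<Longrightarrow> (\<mu> has_field_derivative m (y $ 0)) (at (y $ 0))"
begin

text \<open>The block candidate is checked to be a right inverse, which determines the inverse of a
  square matrix; \<epsilon> is its own inverse.\<close>

lemma ginv_M:
  assumes x: "x \<in> W"
  shows "ginv M 0 0 x = \<epsilon> * exp (- (2 * \<mu> (x $ 0) + b * u x))"
    and "i \<noteq> 0 \<Longrightarrow> ginv M 0 i x = 0" and "i \<noteq> 0 \<Longrightarrow> ginv M i 0 x = 0"
    and "i \<noteq> 0 \<Longrightarrow> j \<noteq> 0 \<Longrightarrow>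
      ginv M i j x = exp (- (2 * \<mu> (x $ 0) + (1 - b) * u x)) * k i j x"
proof -
  define B :: "real ^ 4 ^ 4" where "B = (\<chi> i j. if i = 0 \<and> j = 0 then \<epsilon> * exp (- (2 * \<mu> (x $ 0) + b * u x))
     else if i \<noteq> 0 \<and> j \<noteq> 0 then exp (- (2 * \<mu> (x $ 0) + (1 - b) * u x)) * k i j x else 0)"
  have B: "B $ 0 $ 0 = \<epsilon> * exp (- (2 * \<mu> (x $ 0) + b * u x))"
    "i \<noteq> 0 \<Longrightarrow> B $ 0 $ i = 0" "i \<noteq> 0 \<Longrightarrow> B $ i $ 0 = 0"
    "i \<noteq> 0 \<Longrightarrow> j \<noteq> 0 \<Longrightarrow> B $ i $ j = exp (- (2 * \<mu> (x $ 0) + (1 - b) * u x)) * k i j x" for i j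
    by (simp_all add: B_def)
  have "(\<Sum>l\<in>UNIV. M x $ i $ l * B $ l $ j) = (if i = j then 1 else 0)" for i j
  proof -
    have ee: "exp s * exp (- s) = 1" for s :: real by (simp flip: exp_add)
    consider "i = 0" "j = 0" | "i = 0" "j \<noteq> 0" | "i \<noteq> 0" "j = 0" | "i \<noteq> 0" "j \<noteq> 0" by blast
    then show ?thesis
    proof cases
      case 1
      have "\<epsilon> * exp (2 * \<mu> (x $ 0) + b * u x) * (\<epsilon> * exp (- (2 * \<mu> (x $ 0) + b * u x))) = \<epsilon>\<^sup>2 * 1"
        unfolding ee[of "2 * \<mu> (x $ 0) + b * u x", symmetric] by (simp only: power2_eq_square mult_ac)
      then show ?thesis using 1 by (simp add: sum_split_0 B M_00[OF x] M_0i[OF x] \<epsilon>_sq)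
    next
      case 4
      have "(\<Sum>l\<in>spatial. M x $ i $ l * B $ l $ j)
          = (\<Sum>l\<in>spatial. (exp (2 * \<mu> (x $ 0) + (1 - b) * u x) * exp (- (2 * \<mu> (x $ 0) + (1 - b) * u x)))
              * (h i l x * k l j x))"
        using 4 by (intro sum.cong refl) (simp only: Compl_iff singleton_iff not_False_eq_True B M_ij[OF x] mult_ac)
      also have "\<dots> = (\<Sum>l\<in>spatial. h i l x * k l j x)" unfolding ee by simp
      finally show ?thesis using 4 by (simp add: sum_split_0 B M_i0[OF x] hk[OF x])
    qed (simp_all add: sum_split_0 B M_0i[OF x] M_i0[OF x])
  qed
  then have "M x ** B = mat 1"
    by (simp add: matrix_matrix_mult_def mat_def vec_eq_iff)
  then have "ginv M i j x = B $ i $ j" for i j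
    unfolding ginv_def using matrix_inv_unique by metis
  with B show "ginv M 0 0 x = \<epsilon> * exp (- (2 * \<mu> (x $ 0) + b * u x))"
    "i \<noteq> 0 \<Longrightarrow> ginv M 0 i x = 0" "i \<noteq> 0 \<Longrightarrow> ginv M i 0 x = 0"
    "i \<noteq> 0 \<Longrightarrow> j \<noteq> 0 \<Longrightarrow>
      ginv M i j x = exp (- (2 * \<mu> (x $ 0) + (1 - b) * u x)) * k i j x"
    by simp_all
qed

lemma pd_warp:
  assumes x: "x \<in> W"
  shows "pd l (\<lambda>y. exp (2 * \<mu> (y $ 0) + c * u y)) x
      = exp (2 * \<mu> (x $ 0) + c * u x) * ((if l = 0 then 2 * m (x $ 0) else 0) + c * pd l u x)"
    and "(\<lambda>y. exp (2 * \<mu> (y $ 0) + c * u y)) differentiable (at x)"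
proof -
  note t = pd_time[OF x \<mu>_deriv[OF x]]
  have d: "(\<lambda>y. 2 * \<mu> (y $ 0) + c * u y) differentiable (at x)"
    by (intro differentiable_add differentiable_mult differentiable_const t u_diff[OF x])
  show "(\<lambda>y. exp (2 * \<mu> (y $ 0) + c * u y)) differentiable (at x)"
    by (rule differentiable_comp_real[OF d DERIV_exp])
  show "pd l (\<lambda>y. exp (2 * \<mu> (y $ 0) + c * u y)) x
      = exp (2 * \<mu> (x $ 0) + c * u x) * ((if l = 0 then 2 * m (x $ 0) else 0) + c * pd l u x)"
    unfolding pd_comp[OF d DERIV_exp]
    by (simp add: pd_add pd_cmult t u_diff[OF x])
qed

lemma pd_M:
  assumes x: "x \<in> W"
  shows "pd l (\<lambda>y. M y $ 0 $ 0) x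
      = \<epsilon> * exp (2 * \<mu> (x $ 0) + b * u x) * ((if l = 0 then 2 * m (x $ 0) else 0) + b * pd l u x)"
    and "i \<noteq> 0 \<Longrightarrow> pd l (\<lambda>y. M y $ 0 $ i) x = 0" and "i \<noteq> 0 \<Longrightarrow> pd l (\<lambda>y. M y $ i $ 0) x = 0"
    and "i \<noteq> 0 \<Longrightarrow> j \<noteq> 0 \<Longrightarrow> pd l (\<lambda>y. M y $ i $ j) x = exp (2 * \<mu> (x $ 0) + (1 - b) * u x) *
      (((if l = 0 then 2 * m (x $ 0) else 0) + (1 - b) * pd l u x) * h i j x + pd l (h i j) x)"
proof -
  note c = pd_cong[OF open_W x]
  have "pd l (\<lambda>y. M y $ 0 $ 0) x = pd l (\<lambda>y. \<epsilon> * exp (2 * \<mu> (y $ 0) + b * u y)) x"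
    by (rule c) (rule M_00)
  then show "pd l (\<lambda>y. M y $ 0 $ 0) x
      = \<epsilon> * exp (2 * \<mu> (x $ 0) + b * u x) * ((if l = 0 then 2 * m (x $ 0) else 0) + b * pd l u x)"
    by (simp add: pd_cmult pd_warp[OF x])
  show "pd l (\<lambda>y. M y $ 0 $ i) x = 0" if "i \<noteq> 0"
    using c[of "\<lambda>y. M y $ 0 $ i" "\<lambda>y. 0"] that M_0i by simp
  show "pd l (\<lambda>y. M y $ i $ 0) x = 0" if "i \<noteq> 0"
    using c[of "\<lambda>y. M y $ i $ 0" "\<lambda>y. 0"] that M_i0 by simp
  show "pd l (\<lambda>y. M y $ i $ j) x = exp (2 * \<mu> (x $ 0) + (1 - b) * u x) *
      (((if l = 0 then 2 * m (x $ 0) else 0) + (1 - b) * pd l u x) * h i j x + pd l (h i j) x)"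
    if ij: "i \<noteq> 0" "j \<noteq> 0"
  proof -
    have "pd l (\<lambda>y. M y $ i $ j) x = pd l (\<lambda>y. exp (2 * \<mu> (y $ 0) + (1 - b) * u y) * h i j y) x"
      by (rule c) (rule M_ij[OF _ ij])
    also have "\<dots> = exp (2 * \<mu> (x $ 0) + (1 - b) * u x) *
        ((if l = 0 then 2 * m (x $ 0) else 0) + (1 - b) * pd l u x) * h i j x
        + exp (2 * \<mu> (x $ 0) + (1 - b) * u x) * pd l (h i j) x"
      by (subst pd_mult) (simp_all only: pd_warp[OF x] h_diff[OF x] ij not_False_eq_True)
    finally show ?thesis by (simp only: ring_distribs mult.assoc)
  qed
qed

text \<open>With X and Y the exponents of the two blocks, exponentials either cancel or occur as exp
  (Y - X) or exp (X - Y), in which \<mu> drops out. This is why the exponentials of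
  \<open>conn\<close> involve \<open>u\<close> alone.\<close>

lemma christoffel_M:
  assumes x: "x \<in> W"
  shows "christoffel M l i j x = conn \<epsilon> b m l i j x"
proof -
  define X where "X = 2 * \<mu> (x $ 0) + b * u x"
  define Y where "Y = 2 * \<mu> (x $ 0) + (1 - b) * u x"
  have e: "exp (- X) * (exp X * z) = z" "exp (- Y) * (exp Y * z) = z" for z
    by (simp_all add: mult.assoc[symmetric] exp_add[symmetric])
  have "- X + Y = (1 - 2 * b) * u x" "- Y + X = (2 * b - 1) * u x"
    by (simp_all add: X_def Y_def algebra_simps)
  then have XY: "exp (- X) * (exp Y * z) = exp ((1 - 2 * b) * u x) * z"
    "exp (- Y) * (exp X * z) = exp ((2 * b - 1) * u x) * z" for z
    by (simp_all only: mult.assoc[symmetric] exp_add[symmetric])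
  note g = ginv_M[OF x, folded X_def Y_def] and d = pd_M[OF x, folded X_def Y_def] and s = u_static[OF x]
  show ?thesis
  proof (cases "l = 0")
    case True
    have *: "christoffel M 0 i j x = \<epsilon> * exp (- X) / 2 *
        (pd i (\<lambda>y. M y $ 0 $ j) x + pd j (\<lambda>y. M y $ 0 $ i) x - pd 0 (\<lambda>y. M y $ i $ j) x)" for i j
      by (simp add: christoffel_def sum_split_0 g)
    have E: "\<epsilon> * exp (- X) / 2 * (\<epsilon> * exp X * z) = z / 2" for z
    proof -
      have "\<epsilon> * exp (- X) / 2 * (\<epsilon> * exp X * z) = \<epsilon>\<^sup>2 * (exp (- X) * (exp X * z)) / 2"
        by (simp add: power2_eq_square)
      then show ?thesis by (simp only: e \<epsilon>_sq mult_1_left)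
    qed
    have F: "\<epsilon> * exp (- X) / 2 * (- (exp Y * z)) = - \<epsilon> * exp ((1 - 2 * b) * u x) * z / 2" for z
      using XY(1)[of z] by simp
    have "christoffel M 0 0 0 x = \<epsilon> * exp (- X) / 2 * (\<epsilon> * exp X * (2 * m (x $ 0)))"
      by (simp add: * d s)
    moreover have "christoffel M 0 0 c x = \<epsilon> * exp (- X) / 2 * (\<epsilon> * exp X * (b * pd c u x))"
      "christoffel M 0 c 0 x = \<epsilon> * exp (- X) / 2 * (\<epsilon> * exp X * (b * pd c u x))" if "c \<noteq> 0" for c
      using that by (simp_all add: * d)
    moreover have "christoffel M 0 i j x = \<epsilon> * exp (- X) / 2 * (- (exp Y * (2 * m (x $ 0) * h i j x)))"
      if "i \<noteq> 0" "j \<noteq> 0"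
      using that by (simp add: * d s h_static[OF x])
    ultimately show ?thesis
      unfolding True E F by (auto simp: conn_def)
  next
    case l: False
    have *: "christoffel M l i j x = (\<Sum>r\<in>spatial. exp (- Y) * k l r x / 2 *
        (pd i (\<lambda>y. M y $ r $ j) x + pd j (\<lambda>y. M y $ r $ i) x - pd r (\<lambda>y. M y $ i $ j) x))"
      using l by (simp add: christoffel_def sum_split_0 g)
    have time: "(\<Sum>r\<in>spatial. exp (- Y) * k l r x / 2 * (exp Y * (2 * m (x $ 0) * h r j x)))
        = (if l = j then m (x $ 0) else 0)" if "j \<noteq> 0" for j
    proof -
      have "(\<Sum>r\<in>spatial. exp (- Y) * k l r x / 2 * (exp Y * (2 * m (x $ 0) * h r j x)))
          = (\<Sum>r\<in>spatial. m (x $ 0) * (k l r x * h r j x))"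
        by (intro sum.cong refl) (use e(2) in \<open>simp add: algebra_simps\<close>)
      then show ?thesis using l that kh[OF x, of l j] by (simp flip: sum_distrib_left)
    qed
    consider "i = 0" "j = 0" | "i = 0" "j \<noteq> 0" | "i \<noteq> 0" "j = 0" | "i \<noteq> 0" "j \<noteq> 0" by blast
    then show ?thesis
    proof cases
      case 1
      have "christoffel M l 0 0 x = (\<Sum>r\<in>spatial. - \<epsilon> * b / 2 * exp ((2 * b - 1) * u x) * (k l r x * pd r u x))"
        unfolding *[unfolded 1]
        by (intro sum.cong refl) (use XY(2) in \<open>simp add: d algebra_simps\<close>)
      then show ?thesis
        using 1 l by (simp add: conn_def w_def sum_distrib_left mult_ac)
    next
      case 2
      have "christoffel M l i j x = (\<Sum>r\<in>spatial. exp (- Y) * k l r x / 2 * (exp Y * (2 * m (x $ 0) * h r j x)))"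
        unfolding * using 2 by (intro sum.cong refl) (simp add: d s h_static[OF x])
      also note time[OF 2(2)]
      finally show ?thesis using 2 l by (simp add: conn_def)
    next
      case 3
      have "christoffel M l i j x = (\<Sum>r\<in>spatial. exp (- Y) * k l r x / 2 * (exp Y * (2 * m (x $ 0) * h r i x)))"
        unfolding * using 3 by (intro sum.cong refl) (simp add: d s h_static[OF x])
      also note time[OF 3(1)]
      finally show ?thesis using 3 l by (simp add: conn_def)
    next
      case 4
      have "christoffel M l i j x = (\<Sum>r\<in>spatial. k l r x / 2 * (pd i (h r j) x + pd j (h r i) x - pd r (h i j) x)
          + (1 - b) / 2 * (pd i u x * (k l r x * h r j x) + pd j u x * (k l r x * h r i x)
            - h i j x * (k l r x * pd r u x)))"
      proof -
        have E: "exp (- Y) * z / 2 * (exp Y * A + exp Y * B - exp Y * C) = z / 2 * (A + B - C)" for z A B C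
        proof -
          have "exp (- Y) * z / 2 * (exp Y * A + exp Y * B - exp Y * C)
              = z / 2 * (exp (- Y) * (exp Y * (A + B - C)))"
            by (simp add: algebra_simps)
          then show ?thesis by (simp only: e)
        qed
        show ?thesis
          unfolding *
        proof (intro sum.cong refl)
          fix r assume "r \<in> spatial"
          then have r: "r \<noteq> 0" by simp
          show "exp (- Y) * k l r x / 2 * (pd i (\<lambda>y. M y $ r $ j) x + pd j (\<lambda>y. M y $ r $ i) x
              - pd r (\<lambda>y. M y $ i $ j) x)
            = k l r x / 2 * (pd i (h r j) x + pd j (h r i) x - pd r (h i j) x)
              + (1 - b) / 2 * (pd i u x * (k l r x * h r j x) + pd j u x * (k l r x * h r i x)
                - h i j x * (k l r x * pd r u x))"
            unfolding d(4)[OF r 4(2)] d(4)[OF r 4(1)] d(4)[OF 4] E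
            using 4 r by (simp add: field_simps)
        qed
      qed
      also have "\<dots> = \<gamma> l i j x + (1 - b) / 2 * (pd i u x * (\<Sum>r\<in>spatial. k l r x * h r j x)
          + pd j u x * (\<Sum>r\<in>spatial. k l r x * h r i x) - h i j x * w l x)"
        by (simp only: sum.distrib sum_subtractf \<gamma>_def w_def flip: sum_distrib_left)
      finally show ?thesis
        using 4 l by (simp add: conn_def conformal_shift_def kh[OF x])
    qed
  qed
qed

lemma ricci_M: "x \<in> W \<Longrightarrow> ricci M i j x = ricci_of (conn \<epsilon> b m) i j x"
  unfolding ricci_eq_ricci_of by (rule ricci_of_cong[OF open_W]) (auto simp: christoffel_M)

end

section \<open>The wave operator on fields linear in \<open>u\<close> and \<mu>\<close>

context block_metric
begin

text \<open>The bracket of the Ricci tensor reappears: grad2 gets b/2 from the 00 term and (3 - 2)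
  (1 - b)/2 from the spatial trace, in total 1/2. So in the application the \<open>u\<close> part of
  the field contributes nothing. The factor 2 of m^2 is 3 - 1, spatial trace minus the 00
  term.\<close>

lemma box_M:
  assumes x: "x \<in> W" and m: "(m has_field_derivative m') (at (x $ 0))"
    and \<phi>: "\<And>y. y \<in> W \<Longrightarrow> \<phi> y = s * u y + c * \<mu> (y $ 0)"
  shows "box M \<phi> x = \<epsilon> * exp (- (2 * \<mu> (x $ 0) + b * u x)) * c * (m' + 2 * (m (x $ 0))\<^sup>2)
    + exp (- (2 * \<mu> (x $ 0) + (1 - b) * u x)) * s * (lap x + grad2 x / 2)"
proof -
  let ?N = "spatial" and ?m = "m (x $ 0)" and ?a = "(1 - b) / 2"
  define X where "X = 2 * \<mu> (x $ 0) + b * u x"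
  define Y where "Y = 2 * \<mu> (x $ 0) + (1 - b) * u x"
  have "- X + (2 * b - 1) * u x = - Y" "- Y + (1 - 2 * b) * u x = - X"
    by (simp_all add: X_def Y_def algebra_simps)
  then have XY: "exp (- X) * exp ((2 * b - 1) * u x) = exp (- Y)"
    "exp (- Y) * exp ((1 - 2 * b) * u x) = exp (- X)"
    by (simp_all only: exp_add[symmetric])
  have d\<phi>: "pd i \<phi> y = s * pd i u y + (if i = 0 then c * m (y $ 0) else 0)" if y: "y \<in> W" for i y
  proof -
    note t = pd_time[OF y \<mu>_deriv[OF y]]
    have "pd i \<phi> y = pd i (\<lambda>y. s * u y + c * \<mu> (y $ 0)) y"
      by (rule pd_cong[OF open_W y]) (rule \<phi>)
    also have "\<dots> = s * pd i u y + (if i = 0 then c * m (y $ 0) else 0)"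
      using u_diff[OF y] t by (simp add: pd_add pd_cmult differentiable_mult)
    finally show ?thesis .
  qed
  have d\<phi>_0: "pd 0 \<phi> x = c * ?m"
    by (simp add: d\<phi> x u_static)
  have d\<phi>_i: "pd i \<phi> x = s * pd i u x" if "i \<noteq> 0" for i
    using that by (simp add: d\<phi> x)
  have dd\<phi>_0: "pd 0 (pd 0 \<phi>) x = c * m'"
  proof -
    have "pd 0 (pd 0 \<phi>) x = pd 0 (\<lambda>y. c * m (y $ 0)) x"
      by (rule pd_cong[OF open_W x]) (simp add: d\<phi> u_static)
    then show ?thesis by (simp add: pd_cmult pd_time[OF x m])
  qed
  have dd\<phi>: "pd j (pd i \<phi>) x = s * pd j (pd i u) x" if "i \<noteq> 0" for i j
  proof -
    have "pd j (pd i \<phi>) x = pd j (\<lambda>y. s * pd i u y) x"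
      by (rule pd_cong[OF open_W x]) (simp add: d\<phi> that)
    then show ?thesis by (simp add: pd_cmult du_diff[OF x])
  qed
  note G = christoffel_M[OF x]
  have time: "(\<Sum>l\<in>UNIV. christoffel M l 0 0 x * pd l \<phi> x)
      = c * ?m\<^sup>2 - \<epsilon> * b / 2 * s * (exp ((2 * b - 1) * u x) * grad2 x)"
  proof -
    have "(\<Sum>l\<in>?N. christoffel M l 0 0 x * pd l \<phi> x)
        = (\<Sum>l\<in>?N. - (\<epsilon> * b / 2 * s * exp ((2 * b - 1) * u x)) * (pd l u x * w l x))"
      by (intro sum.cong refl) (simp add: G conn_def d\<phi>_i)
    also have "\<dots> = - (\<epsilon> * b / 2 * s * exp ((2 * b - 1) * u x)) * grad2 x"
      unfolding grad2_def by (rule sum_distrib_left[symmetric])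
    finally show ?thesis
      unfolding sum_split_0 by (simp add: G[of 0 0 0] conn_def d\<phi>_0 power2_eq_square)
  qed
  have space: "pd j (pd i \<phi>) x - (\<Sum>l\<in>UNIV. christoffel M l j i x * pd l \<phi> x)
      = s * hess i j x - s * ?a * (2 * (pd i u x * pd j u x) - h i j x * grad2 x)
        + \<epsilon> * exp ((1 - 2 * b) * u x) * c * ?m\<^sup>2 * h i j x"
    if ij: "i \<noteq> 0" "j \<noteq> 0" for i j
  proof -
    let ?S = "conformal_shift ?a (\<lambda>i. pd i u x) (\<lambda>l. w l x) (\<lambda>i j. h i j x)"
    have S: "(\<Sum>l\<in>?N. pd l u x * ?S l j i) = ?a * (2 * (pd i u x * pd j u x) - h i j x * grad2 x)"
      using ij by (subst contract_shift) (auto simp: h_sym h_w x grad2_def)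
    have "(\<Sum>l\<in>?N. christoffel M l j i x * pd l \<phi> x)
        = (\<Sum>l\<in>?N. s * (pd l u x * \<gamma> l j i x + pd l u x * ?S l j i))"
      using ij by (intro sum.cong refl) (simp add: G conn_def d\<phi>_i algebra_simps)
    also have "\<dots> = s * ((\<Sum>l\<in>?N. pd l u x * \<gamma> l j i x)
        + ?a * (2 * (pd i u x * pd j u x) - h i j x * grad2 x))"
      unfolding S[symmetric] by (simp only: sum.distrib flip: sum_distrib_left)
    finally show ?thesis
      using ij by (simp add: sum_split_0 G conn_def d\<phi>_0 dd\<phi> hess_def h_sym[OF x ij]
          power2_eq_square algebra_simps)
  qed
  note g = ginv_M[OF x, folded X_def Y_def]
  have "box M \<phi> x = \<epsilon> * exp (- X) * (c * m' - (c * ?m\<^sup>2 - \<epsilon> * b / 2 * s * (exp ((2 * b - 1) * u x) * grad2 x)))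
      + (\<Sum>j\<in>?N. \<Sum>i\<in>?N. exp (- Y) * k j i x *
          (s * hess i j x - s * ?a * (2 * (pd i u x * pd j u x) - h i j x * grad2 x)
            + \<epsilon> * exp ((1 - 2 * b) * u x) * c * ?m\<^sup>2 * h i j x))"
    unfolding box_def
    by (subst (1 2) sum_split_0) (simp add: g time dd\<phi>_0 space)
  also have "(\<Sum>j\<in>?N. \<Sum>i\<in>?N. exp (- Y) * k j i x *
          (s * hess i j x - s * ?a * (2 * (pd i u x * pd j u x) - h i j x * grad2 x)
            + \<epsilon> * exp ((1 - 2 * b) * u x) * c * ?m\<^sup>2 * h i j x))
      = (\<Sum>j\<in>?N. \<Sum>i\<in>?N. exp (- Y) * s * (k j i x * hess i j x)
          - exp (- Y) * s * ?a * 2 * (k j i x * (pd i u x * pd j u x))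
          + (exp (- Y) * s * ?a * grad2 x + exp (- Y) * exp ((1 - 2 * b) * u x) * \<epsilon> * c * ?m\<^sup>2)
            * (k j i x * h i j x))"
    by (intro sum.cong refl) (simp add: algebra_simps)
  also have "\<dots> = exp (- Y) * s * lap x - exp (- Y) * s * ?a * 2 * grad2 x
      + (exp (- Y) * s * ?a * grad2 x + exp (- Y) * exp ((1 - 2 * b) * u x) * \<epsilon> * c * ?m\<^sup>2) * 3"
    by (simp only: sum.distrib sum_subtractf trace_hess[OF x] trace_kh[OF x] trace_uu[OF x]
        flip: sum_distrib_left)
  also have "\<epsilon> * exp (- X) * (c * m' - (c * ?m\<^sup>2 - \<epsilon> * b / 2 * s * (exp ((2 * b - 1) * u x) * grad2 x)))
      = \<epsilon> * exp (- X) * c * (m' - ?m\<^sup>2)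
        + \<epsilon>\<^sup>2 * (exp (- X) * exp ((2 * b - 1) * u x)) * s * b / 2 * grad2 x"
    by (simp add: power2_eq_square algebra_simps)
  finally have "box M \<phi> x = \<epsilon> * exp (- X) * c * (m' - ?m\<^sup>2) + exp (- Y) * s * b / 2 * grad2 x
      + (exp (- Y) * s * lap x - exp (- Y) * s * ?a * 2 * grad2 x
      + (exp (- Y) * s * ?a * grad2 x + exp (- X) * \<epsilon> * c * ?m\<^sup>2) * 3)"
    unfolding XY \<epsilon>_sq by simp
  then show ?thesis
    unfolding X_def[symmetric] Y_def[symmetric] by (simp add: field_simps)
qed

end

text \<open>Trace reversal in dimension 4: the scalar curvature is \<kappa> (K + 4 v), so
  subtracting half of it times the metric changes + v into - (K/2 + v).\<close>

lemma einstein_of_ricci: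
  assumes sym: "transpose (g x) = g x" and inv: "invertible (g x)"
    and ricci: "\<And>a b. ricci g a b x = \<kappa> * (p a * p b + g x $ a $ b * v)"
  shows "einstein g a b x = \<kappa> * (p a * p b - g x $ a $ b *
    (1 / 2 * (\<Sum>\<alpha>\<in>UNIV. \<Sum>\<beta>\<in>UNIV. ginv g \<alpha> \<beta> x * p \<alpha> * p \<beta>) + v))"
proof -
  let ?K = "\<Sum>\<alpha>\<in>UNIV. \<Sum>\<beta>\<in>UNIV. ginv g \<alpha> \<beta> x * p \<alpha> * p \<beta>"
  have gsym: "g x $ a $ b = g x $ b $ a" for a b
    using arg_cong[OF sym, of "\<lambda>A. A $ b $ a"] by (simp add: transpose_def)
  have "(\<Sum>b\<in>UNIV. ginv g a b x * g x $ a $ b) = (matrix_inv (g x) ** g x) $ a $ a" for a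
    by (simp add: ginv_def matrix_matrix_mult_def gsym[of a])
  then have diag: "(\<Sum>b\<in>UNIV. ginv g a b x * g x $ a $ b) = 1" for a
    using matrix_inv(1)[OF inv] by (simp add: mat_def)
  have trace: "(\<Sum>a\<in>UNIV. \<Sum>b\<in>UNIV. ginv g a b x * g x $ a $ b) = 4"
    by (simp add: diag)
  have "scalar_curvature g x = (\<Sum>a\<in>UNIV. \<Sum>b\<in>UNIV. \<kappa> * (ginv g a b x * p a * p b)
      + \<kappa> * v * (ginv g a b x * g x $ a $ b))"
    unfolding scalar_curvature_def ricci by (intro sum.cong refl) (simp add: algebra_simps)
  also have "\<dots> = \<kappa> * ?K + \<kappa> * v * 4"
    by (simp only: sum.distrib trace flip: sum_distrib_left)
  finally show ?thesis
    unfolding einstein_def ricci by (simp add: field_simps)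
qed

section \<open>Smoothness of the inverse metric and invariance of the signature\<close>

lemma smooth_on_det:
  fixes F :: "real ^ 4 \<Rightarrow> real ^ 4 ^ 4"
  assumes "open W" "\<And>i j. smooth_on W (\<lambda>y. F y $ i $ j)"
  shows "smooth_on W (\<lambda>y. det (F y))"
  unfolding det_def
  by (intro smooth_on_sum smooth_on_mult smooth_on_prod smooth_on_const assms)

text \<open>Cramer's rule: each entry of the inverse is a quotient of determinants, which are
  polynomials in the metric components.\<close>

lemma smooth_on_ginv:
  assumes W: "open W" and g: "\<And>i j. smooth_on W (\<lambda>y. g y $ i $ j)"
    and inv: "\<And>y. y \<in> W \<Longrightarrow> invertible (g y)"
  shows "smooth_on W (ginv g i j)"
proof -
  have cof: "smooth_on W (\<lambda>y. det ((\<chi> a c. if c = i then axis j 1 $ a else g y $ a $ c) :: real ^ 4 ^ 4))"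
  proof (rule smooth_on_det[OF W])
    fix a c
    show "smooth_on W (\<lambda>y. (\<chi> a c. if c = i then axis j 1 $ a else g y $ a $ c) $ a $ c)"
      by (cases "c = i") (simp_all add: smooth_on_const g)
  qed
  have eq: "ginv g i j y = det (\<chi> a c. if c = i then axis j 1 $ a else g y $ a $ c) * inverse (det (g y))"
    if y: "y \<in> W" for y
  proof -
    have nz: "det (g y) \<noteq> 0" using inv[OF y] by (simp add: invertible_det_nz)
    have "g y *v (\<chi> a. matrix_inv (g y) $ a $ j) = axis j 1"
      using arg_cong[OF matrix_inv(2)[OF inv[OF y]], of "\<lambda>A. A $ r $ j" for r]
      by (simp add: vec_eq_iff matrix_vector_mult_def matrix_matrix_mult_def mat_def axis_def)
    from this[unfolded cramer[OF nz], THEN arg_cong, of "\<lambda>v. v $ i"]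
    show ?thesis by (simp add: ginv_def field_simps)
  qed
  have "smooth_on W (\<lambda>y. det ((\<chi> a c. if c = i then axis j 1 $ a else g y $ a $ c) :: real ^ 4 ^ 4)
      * inverse (det (g y)))"
    using inv by (intro smooth_on_mult smooth_on_inverse smooth_on_det cof W g) (simp add: invertible_det_nz)
  then show ?thesis
    using smooth_on_cong[OF W eq] by simp
qed

text \<open>\<open>minkowski\<close> squares to the identity, so its determinant is nonzero, and
  congruence passes this on to \<open>A\<close>.\<close>

lemma lorentzian_invertible:
  assumes "lorentzian A"
  shows "invertible A"
proof -
  obtain P where P: "transpose P ** A ** P = minkowski"
    using assms by (auto simp: lorentzian_def)
  have "(\<Sum>k\<in>UNIV. minkowski $ i $ k * minkowski $ k $ j) = (if i = j then 1 else 0)" for i j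
  proof -
    have "(\<Sum>k\<in>UNIV. minkowski $ i $ k * minkowski $ k $ j)
        = (\<Sum>k\<in>UNIV. if k = i then if i = j then 1 else 0 else 0)"
      by (intro sum.cong refl) (auto simp: minkowski_def)
    then show ?thesis by simp
  qed
  then have "minkowski ** minkowski = mat 1"
    by (simp add: matrix_matrix_mult_def mat_def vec_eq_iff)
  then have "det (minkowski ** minkowski) = 1" by simp
  then have "det minkowski \<noteq> 0" by (auto simp: det_mul)
  then show ?thesis
    unfolding P[symmetric] by (simp add: det_mul invertible_det_nz)
qed

text \<open>Lets the new metric inherit its signature from the vacuum metric by a rescaling of the
  coordinate frame.\<close>

lemma lorentzian_congruence:
  assumes A: "lorentzian A" and sym: "transpose A' = A'"
    and D: "invertible D" "transpose D ** A' ** D = A"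
  shows "lorentzian A'"
proof -
  obtain P where P: "invertible P" "transpose P ** A ** P = minkowski"
    using A by (auto simp: lorentzian_def)
  have "transpose (D ** P) ** A' ** (D ** P) = transpose P ** (transpose D ** A' ** D) ** P"
    by (simp add: matrix_transpose_mul matrix_mul_assoc)
  then have "transpose (D ** P) ** A' ** (D ** P) = minkowski"
    using D(2) P(2) by simp
  moreover have "invertible (D ** P)"
    using D(1) P(1) by (simp add: invertible_mult)
  ultimately show ?thesis
    using sym unfolding lorentzian_def by blast
qed

section \<open>The scalar field solution\<close>

text \<open>The relations in the form the field equations consume: the second matches the u_i u_j
  terms, the third serves both the 00 equation and the exponent of the potential, the fourth gives
  the amplitude of the potential.\<close>

lemma coupling_constants:
  fixes \<kappa> \<epsilon> \<beta> \<xi>\<^sub>0 \<xi>\<^sub>1 \<xi>\<^sub>2 V\<^sub>0 C :: real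
  assumes "\<kappa> > 0" and \<beta>: "\<beta> \<in> {- 1 <..< 1}"
    and xi0: "\<xi>\<^sub>0 = sqrt ((1 - \<beta>\<^sup>2) / (2 * \<kappa>))" and xi1: "\<xi>\<^sub>1 = \<beta> / \<xi>\<^sub>0"
    and xi2: "(\<beta>\<^sup>2 - 2 * \<xi>\<^sub>0\<^sup>2 * \<kappa>) * \<xi>\<^sub>2 = 2 * \<xi>\<^sub>0\<^sup>2 * \<kappa>"
    and V0: "(2 * \<xi>\<^sub>0\<^sup>2 * \<kappa> - \<beta>\<^sup>2)\<^sup>2 * V\<^sub>0 = 2 * \<epsilon> * \<xi>\<^sub>0\<^sup>2 * C\<^sup>2 * (\<beta>\<^sup>2 - 6 * \<xi>\<^sub>0\<^sup>2 * \<kappa>)"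
  shows "\<xi>\<^sub>0 > 0" and "\<kappa> * \<xi>\<^sub>0\<^sup>2 = 1 / 2 - \<beta>\<^sup>2 / 2"
    and "(\<xi>\<^sub>1\<^sup>2 / \<kappa> - 2) * \<xi>\<^sub>2 = 2"
    and "\<kappa> * V\<^sub>0 = \<epsilon> * C\<^sup>2 * (\<xi>\<^sub>2 - 2 * \<xi>\<^sub>2\<^sup>2)"
proof -
  have b: "\<beta>\<^sup>2 < 1" using \<beta> by (simp add: abs_square_less_1 abs_less_iff)
  then show pos: "\<xi>\<^sub>0 > 0" using \<open>\<kappa> > 0\<close> by (simp add: xi0)
  show q: "\<kappa> * \<xi>\<^sub>0\<^sup>2 = 1 / 2 - \<beta>\<^sup>2 / 2"
    using b \<open>\<kappa> > 0\<close> by (simp add: xi0 field_simps)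
  define q where "q = \<xi>\<^sub>0\<^sup>2 * \<kappa>"
  define D where "D = \<beta>\<^sup>2 - 2 * q"
  have q_pos: "q > 0" using pos \<open>\<kappa> > 0\<close> by (simp add: q_def)
  have D: "D * \<xi>\<^sub>2 = 2 * q" using xi2 by (simp add: D_def q_def mult.assoc)
  \<comment> \<open>The right side 2 q is positive, so the relation for \<open>\<xi>\<^sub>2\<close>
    itself excludes the degenerate case beta^2 = 1/2.\<close>
  then have D0: "D \<noteq> 0" using q_pos by auto
  have "\<xi>\<^sub>1\<^sup>2 / \<kappa> - 2 = D / q"
    using pos \<open>\<kappa> > 0\<close> by (simp add: xi1 D_def q_def field_simps)
  then have "(\<xi>\<^sub>1\<^sup>2 / \<kappa> - 2) * \<xi>\<^sub>2 = D * \<xi>\<^sub>2 / q" by simp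
  then show "(\<xi>\<^sub>1\<^sup>2 / \<kappa> - 2) * \<xi>\<^sub>2 = 2" using q_pos by (simp add: D)
  have D_V0: "D\<^sup>2 * V\<^sub>0 = (2 * \<xi>\<^sub>0\<^sup>2 * \<kappa> - \<beta>\<^sup>2)\<^sup>2 * V\<^sub>0"
    by (simp add: D_def q_def power2_eq_square algebra_simps)
  have "D\<^sup>2 * (\<kappa> * V\<^sub>0) = \<kappa> * (D\<^sup>2 * V\<^sub>0)" by simp
  also have "\<dots> = \<epsilon> * C\<^sup>2 * (2 * q * (D - 4 * q))"
    unfolding D_V0 V0 by (simp add: D_def q_def algebra_simps)
  \<comment> \<open>From D xi2 = 2 q follow D^2 xi2 = 2 q D and D^2 xi2^2 = 4 q^2.\<close>
  also have "2 * q * (D - 4 * q) = D\<^sup>2 * (\<xi>\<^sub>2 - 2 * \<xi>\<^sub>2\<^sup>2)"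
    using D by algebra
  finally have "D\<^sup>2 * (\<kappa> * V\<^sub>0) = D\<^sup>2 * (\<epsilon> * C\<^sup>2 * (\<xi>\<^sub>2 - 2 * \<xi>\<^sub>2\<^sup>2))"
    by (simp only: mult_ac)
  then show "\<kappa> * V\<^sub>0 = \<epsilon> * C\<^sup>2 * (\<xi>\<^sub>2 - 2 * \<xi>\<^sub>2\<^sup>2)"
    using D0 by (simp only: mult_cancel_left power_eq_0_iff simp_thms)
qed

theorem theorem1:
  fixes U :: "(real ^ 4) set" and g gt :: metric and \<phi>t :: scalar and \<mu> :: "real \<Rightarrow> real"
    and \<kappa> \<epsilon> \<beta> \<xi>\<^sub>0 \<xi>\<^sub>1 \<xi>\<^sub>2 \<xi>\<^sub>3 V\<^sub>0 C B :: real
  assumes "\<kappa> > 0"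
    and "open U"
    and vacuum: "vacuum_solution U g"
    and symmetric: "static_axisymmetric_on U g"
    and eta_independent: "\<forall>x\<in>U. \<forall>a b. pd 0 (\<lambda>y. g y $ a $ b) x = 0"
    and no_mixed: "\<forall>x\<in>U. \<forall>i. i \<noteq> 0 \<longrightarrow> g x $ i $ 0 = 0"
    and eta_type: "(\<epsilon> = - 1 \<and> (\<forall>x\<in>U. g x $ 0 $ 0 < 0)) \<or> (\<epsilon> = 1 \<and> (\<forall>x\<in>U. g x $ 0 $ 0 > 0))"
    and "\<beta> \<in> {- 1 <..< 1}"
    and xi0: "\<xi>\<^sub>0 = sqrt ((1 - \<beta>\<^sup>2) / (2 * \<kappa>))"
    and xi1: "\<xi>\<^sub>1 = - \<xi>\<^sub>3" and xi3: "- \<xi>\<^sub>3 = \<beta> / \<xi>\<^sub>0"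
    and xi2: "(\<beta>\<^sup>2 - 2 * \<xi>\<^sub>0\<^sup>2 * \<kappa>) * \<xi>\<^sub>2 = 2 * \<xi>\<^sub>0\<^sup>2 * \<kappa>"
    and V0: "(2 * \<xi>\<^sub>0\<^sup>2 * \<kappa> - \<beta>\<^sup>2)\<^sup>2 * V\<^sub>0 = 2 * \<epsilon> * \<xi>\<^sub>0\<^sup>2 * C\<^sup>2 * (\<beta>\<^sup>2 - 6 * \<xi>\<^sub>0\<^sup>2 * \<kappa>)"
    and mu: "\<mu> = (\<lambda>\<eta>. \<xi>\<^sub>2 * ln (C * \<eta> + B))"
    and gt: "gt = (\<lambda>x. \<chi> a b. exp (2 * \<mu> (x $ 0)) *
               (if a = 0 \<and> b = 0 then \<epsilon> * \<bar>g x $ 0 $ 0\<bar> powr \<beta>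
                else if a \<noteq> 0 \<and> b \<noteq> 0 then \<bar>g x $ 0 $ 0\<bar> powr (1 - \<beta>) * g x $ a $ b
                else 0))"
    and phit: "\<phi>t = (\<lambda>x. \<xi>\<^sub>0 * ln \<bar>g x $ 0 $ 0\<bar> + \<xi>\<^sub>1 / \<kappa> * \<mu> (x $ 0))"
  shows "einstein_scalar_solution \<kappa> (\<lambda>s. V\<^sub>0 * exp (\<xi>\<^sub>3 * s)) {x \<in> U. C * x $ 0 + B > 0} gt \<phi>t"
proof -
  define W where "W = {x \<in> U. C * x $ 0 + B > 0}"
  define h :: "4 \<Rightarrow> 4 \<Rightarrow> scalar" where "h = (\<lambda>i j y. g y $ i $ j)"
  \<comment> \<open>On \<open>W\<close> the product of \<epsilon> and g_00 is |g_00|, but without an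
    absolute value it is visibly smooth.\<close>
  define u :: scalar where "u = (\<lambda>y. ln (\<epsilon> * g y $ 0 $ 0))"
  define m where "m = (\<lambda>\<eta>. \<xi>\<^sub>2 * C / (C * \<eta> + B))"
  define c where "c = \<xi>\<^sub>1 / \<kappa>"
  have xi1': "\<xi>\<^sub>1 = \<beta> / \<xi>\<^sub>0" using xi1 xi3 by simp
  note K = coupling_constants[OF \<open>\<kappa> > 0\<close> \<open>\<beta> \<in> {- 1 <..< 1}\<close> xi0 xi1' xi2 V0]
  have \<epsilon>: "\<epsilon>\<^sup>2 = 1" using eta_type by auto
  have "open {x :: real ^ 4. C * x $ 0 + B > 0}"
    by (intro open_Collect_less continuous_intros)
  then have W: "open W"
    using \<open>open U\<close> by (simp add: W_def Collect_conj_eq open_Int)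
  have WU: "W \<subseteq> U" by (auto simp: W_def)
  have s: "C * x $ 0 + B > 0" if "x \<in> W" for x using that by (simp add: W_def)

  have lor: "lorentzian (g y)" if "y \<in> W" for y
    using vacuum that WU by (auto simp: vacuum_solution_def lorentz_metric_on_def)
  have inv: "invertible (g y)" if "y \<in> W" for y
    using lorentzian_invertible lor that by blast
  have g_smooth: "smooth_on W (\<lambda>y. g y $ i $ j)" for i j
    using vacuum WU by (auto simp: vacuum_solution_def lorentz_metric_on_def intro: smooth_on_subset)
  have g_sym: "g y $ i $ j = g y $ j $ i" if "y \<in> W" for y i j
  proof -
    have "transpose (g y) = g y" using lor[OF that] by (simp add: lorentzian_def)
    from arg_cong[OF this, of "\<lambda>A. A $ j $ i"] show ?thesis by (simp add: transpose_def)
  qed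
  have g_i0: "g y $ i $ 0 = 0" and g_0i: "g y $ 0 $ i = 0" if "y \<in> W" "i \<noteq> 0" for y i
    using no_mixed that WU g_sym[of y 0 i] by auto
  have g00: "\<epsilon> * g y $ 0 $ 0 > 0" if "y \<in> W" for y
    using eta_type that WU by auto
  have abs_g00: "\<bar>g y $ 0 $ 0\<bar> = \<epsilon> * g y $ 0 $ 0" if "y \<in> W" for y
    using eta_type that WU by fastforce
  have g00_u: "g y $ 0 $ 0 = \<epsilon> * exp (u y)" if "y \<in> W" for y
    using g00[OF that] \<epsilon> by (simp add: u_def power2_eq_square mult.assoc[symmetric])
  have powr_u: "\<bar>g y $ 0 $ 0\<bar> powr r = exp (r * u y)" if "y \<in> W" for y r
    using g00[OF that] abs_g00[OF that] by (auto simp: u_def powr_def)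
  have g_static: "pd 0 (\<lambda>y. g y $ i $ j) x = 0" if "x \<in> W" for x i j
    using eta_independent that WU by auto
  have u_smooth: "smooth_on W u"
    unfolding u_def by (intro smooth_on_ln smooth_on_mult smooth_on_const W g_smooth g00)

  \<comment> \<open>Without mixed components, the spatial block of the inverse metric is the inverse
    of the spatial block.\<close>
  interpret spatial_metric W h "ginv g" u
  proof
    show "open W" by (rule W)
    show "smooth_on W (h i j)" for i j by (simp add: h_def g_smooth)
    show "smooth_on W u" by (rule u_smooth)
    show "ginv g i j differentiable (at x)" if "x \<in> W" for x i j
      using smooth_on_differentiable[OF W smooth_on_ginv[OF W g_smooth inv] that] .
    show "h i j x = h j i x" if "x \<in> W" for x i j using g_sym that by (simp add: h_def)
    show "(\<Sum>l\<in>spatial. h i l x * ginv g l j x) = (if i = j then 1 else 0)"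
      if "x \<in> W" "i \<noteq> 0" "j \<noteq> 0" for x i j
      using arg_cong[OF matrix_inv(2)[OF inv[OF that(1)]], of "\<lambda>A. A $ i $ j"] that
      by (simp add: matrix_matrix_mult_def mat_def sum_split_0 g_i0 h_def ginv_def)
    show "(\<Sum>l\<in>spatial. ginv g i l x * h l j x) = (if i = j then 1 else 0)"
      if "x \<in> W" "i \<noteq> 0" "j \<noteq> 0" for x i j
      using arg_cong[OF matrix_inv(1)[OF inv[OF that(1)]], of "\<lambda>A. A $ i $ j"] that
      by (simp add: matrix_matrix_mult_def mat_def sum_split_0 g_0i h_def ginv_def)
    show "pd 0 (h i j) x = 0" if "x \<in> W" for x i j
      using g_static that by (simp add: h_def)
    show "pd 0 u x = 0" if "x \<in> W" for x
    proof -
      have d: "(\<lambda>y. g y $ 0 $ 0) differentiable (at x)"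
        by (rule smooth_on_differentiable[OF W g_smooth that])
      have "((\<lambda>z. ln (\<epsilon> * z)) has_field_derivative 1 / (\<epsilon> * g x $ 0 $ 0) * \<epsilon>) (at (g x $ 0 $ 0))"
        using g00[OF that] by (auto intro!: derivative_eq_intros)
      from pd_comp[OF d this] show ?thesis by (simp add: u_def g_static[OF that])
    qed
  qed

  interpret vac: block_metric W h "ginv g" u g \<epsilon> 1 "\<lambda>_. 0" "\<lambda>_. 0"
    by unfold_locales (auto simp: \<epsilon> g00_u g_i0 g_0i h_def)

  interpret sol: block_metric W h "ginv g" u gt \<epsilon> \<beta> \<mu> m
  proof
    show "\<epsilon>\<^sup>2 = 1" by (rule \<epsilon>)
    show "gt y $ 0 $ 0 = \<epsilon> * exp (2 * \<mu> (y $ 0) + \<beta> * u y)" if "y \<in> W" for y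
      by (simp add: gt powr_u[OF that] exp_add)
    show "gt y $ 0 $ i = 0" "gt y $ i $ 0 = 0" if "i \<noteq> 0" for y i
      using that by (simp_all add: gt)
    show "gt y $ i $ j = exp (2 * \<mu> (y $ 0) + (1 - \<beta>) * u y) * h i j y"
      if "y \<in> W" "i \<noteq> 0" "j \<noteq> 0" for y i j
      using that by (simp add: gt powr_u exp_add h_def)
    show "(\<mu> has_field_derivative m (y $ 0)) (at (y $ 0))" if "y \<in> W" for y
      unfolding mu m_def using s[OF that] by (auto intro!: derivative_eq_intros)
  qed

  have \<mu>_smooth: "smooth_on W (\<lambda>y. \<mu> (y $ 0))"
    unfolding mu
    by (intro smooth_on_mult smooth_on_const smooth_on_ln smooth_on_add smooth_on_nth W s)
  have warp_smooth: "smooth_on W (\<lambda>y. exp (2 * \<mu> (y $ 0) + r * u y))" for r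
    by (intro smooth_on_exp smooth_on_add smooth_on_mult smooth_on_const W \<mu>_smooth u_smooth)
  have gt_smooth: "smooth_on W (\<lambda>y. gt y $ a $ b)" for a b
  proof -
    consider "a = 0" "b = 0" | "a = 0" "b \<noteq> 0" | "a \<noteq> 0" "b = 0" | "a \<noteq> 0" "b \<noteq> 0" by blast
    then show ?thesis
    proof cases
      case 1
      have "smooth_on W (\<lambda>y. \<epsilon> * exp (2 * \<mu> (y $ 0) + \<beta> * u y))"
        by (intro smooth_on_mult smooth_on_const W warp_smooth)
      then show ?thesis using smooth_on_cong[OF W sol.M_00] 1 by simp
    next
      case 2
      then show ?thesis
        using smooth_on_cong[OF W sol.M_0i[OF _ 2(2)]] by (simp add: smooth_on_const)
    next
      case 3
      then show ?thesis
        using smooth_on_cong[OF W sol.M_i0[OF _ 3(1)]] by (simp add: smooth_on_const)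
    next
      case 4
      have "smooth_on W (\<lambda>y. exp (2 * \<mu> (y $ 0) + (1 - \<beta>) * u y) * h a b y)"
        using 4 by (intro smooth_on_mult W warp_smooth h_smooth)
      then show ?thesis using smooth_on_cong[OF W sol.M_ij[OF _ 4]] by simp
    qed
  qed
  have \<phi>_eq: "\<phi>t y = \<xi>\<^sub>0 * u y + c * \<mu> (y $ 0)" if "y \<in> W" for y
    by (simp add: phit u_def abs_g00[OF that] c_def)
  have "smooth_on W (\<lambda>y. \<xi>\<^sub>0 * u y + c * \<mu> (y $ 0))"
    by (intro smooth_on_add smooth_on_mult smooth_on_const W \<mu>_smooth u_smooth)
  then have \<phi>_smooth: "smooth_on W \<phi>t"
    using smooth_on_cong[OF W \<phi>_eq] by simp

  have gt_lor: "lorentzian (gt x)" if x: "x \<in> W" for x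
  proof -
    \<comment> \<open>The exponents are solved from d_0^2 exp (2 mu + beta u) = exp u and d_i^2 exp
      (2 mu + (1 - beta) u) = 1, so that the diagonal rescaling \<open>D\<close> takes
      \<open>gt\<close> back to \<open>g\<close>.\<close>
    define d where "d = (\<lambda>i::4. if i = 0 then exp (- (\<mu> (x $ 0) + (\<beta> - 1) / 2 * u x))
      else exp (- (\<mu> (x $ 0) + (1 - \<beta>) / 2 * u x)))"
    define D :: "real ^ 4 ^ 4" where "D = (\<chi> i j. if i = j then d i else 0)"
    have mult_D: "(A ** D) $ i $ j = A $ i $ j * d j" for A :: "real ^ 4 ^ 4" and i j
    proof -
      have "(A ** D) $ i $ j = (\<Sum>k\<in>UNIV. A $ i $ k * D $ k $ j)"
        by (simp add: matrix_matrix_mult_def)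
      also have "\<dots> = (\<Sum>k\<in>UNIV. if k = j then A $ i $ j * d j else 0)"
        by (intro sum.cong refl) (simp add: D_def)
      finally show ?thesis by simp
    qed
    have "(\<chi> i j. if i = j then 1 / d i else 0) ** D = mat 1"
      by (auto simp: vec_eq_iff mult_D mat_def d_def)
    then have Dinv: "invertible D"
      using matrix_left_right_inverse unfolding invertible_def by blast
    have entry: "(transpose D ** gt x ** D) $ i $ j = d i * gt x $ i $ j * d j" for i j
    proof -
      have "(transpose D ** gt x) $ i $ j = (transpose (gt x) ** D) $ j $ i"
        by (simp add: matrix_matrix_mult_def transpose_def mult.commute)
      then show ?thesis by (simp add: mult_D) (simp add: transpose_def)
    qed
    have "d i * gt x $ i $ j * d j = g x $ i $ j" for i j
    proof -
      consider "i = 0" "j = 0" | "i = 0" "j \<noteq> 0" | "i \<noteq> 0" "j = 0" | "i \<noteq> 0" "j \<noteq> 0" by blast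
      then show ?thesis
      proof cases
        case 1
        have "d 0 * gt x $ 0 $ 0 * d 0 = \<epsilon> * (d 0 * exp (2 * \<mu> (x $ 0) + \<beta> * u x) * d 0)"
          by (simp add: sol.M_00[OF x])
        also have "d 0 * exp (2 * \<mu> (x $ 0) + \<beta> * u x) * d 0 = exp (u x)"
          unfolding d_def by (simp add: field_simps flip: exp_add)
        finally show ?thesis using 1 by (simp add: g00_u[OF x])
      next
        case 4
        have "d i * gt x $ i $ j * d j = h i j x * (d i * exp (2 * \<mu> (x $ 0) + (1 - \<beta>) * u x) * d j)"
          by (simp add: sol.M_ij[OF x 4])
        also have "d i * exp (2 * \<mu> (x $ 0) + (1 - \<beta>) * u x) * d j = 1"
          unfolding d_def using 4 by (simp add: field_simps flip: exp_add)
        finally show ?thesis by (simp add: h_def)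
      qed (simp_all add: sol.M_0i[OF x] sol.M_i0[OF x] g_0i[OF x] g_i0[OF x])
    qed
    then have DgD: "transpose D ** gt x ** D = g x"
      by (simp add: vec_eq_iff entry)
    have "transpose (gt x) = gt x"
      by (auto simp: vec_eq_iff transpose_def gt g_sym[OF x])
    then show ?thesis
      by (rule lorentzian_congruence[OF lor[OF x] _ Dinv DgD])
  qed

  have field_eqs: "(\<forall>a b. einstein gt a b x = \<kappa> * (pd a \<phi>t x * pd b \<phi>t x - gt x $ a $ b *
        (1 / 2 * (\<Sum>\<alpha>\<in>UNIV. \<Sum>\<beta>\<in>UNIV. ginv gt \<alpha> \<beta> x * pd \<alpha> \<phi>t x * pd \<beta> \<phi>t x)
          + V\<^sub>0 * exp (\<xi>\<^sub>3 * \<phi>t x))))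
      \<and> box gt \<phi>t x = deriv (\<lambda>s. V\<^sub>0 * exp (\<xi>\<^sub>3 * s)) (\<phi>t x)" if x: "x \<in> W" for x
  proof -
    define s where "s = C * x $ 0 + B"
    define X where "X = 2 * \<mu> (x $ 0) + \<beta> * u x"
    define Y where "Y = 2 * \<mu> (x $ 0) + (1 - \<beta>) * u x"
    define v where "v = V\<^sub>0 * exp (\<xi>\<^sub>3 * \<phi>t x)"
    define m' where "m' = - \<xi>\<^sub>2 * C\<^sup>2 / s\<^sup>2"
    have s_pos: "s > 0" using s[OF x] by (simp add: s_def)
    have m: "m (x $ 0) = \<xi>\<^sub>2 * C / s" by (simp add: m_def s_def)
    have m_deriv: "(m has_field_derivative m') (at (x $ 0))"
      unfolding m_def m'_def s_def using s[OF x]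
      by (auto intro!: derivative_eq_intros simp: power2_eq_square field_simps)
    have m'2: "m' + 2 * (m (x $ 0))\<^sup>2 = - C\<^sup>2 * (\<xi>\<^sub>2 - 2 * \<xi>\<^sub>2\<^sup>2) / s\<^sup>2"
      using s_pos by (simp add: m m'_def field_simps)

    \<comment> \<open>At b = 1 the bracket drops out of the ij equations, and in the 00 equation its
      factor - eps/2 exp u never vanishes, so each equation isolates one quantity.\<close>
    have vac: "lap x + grad2 x / 2 = 0"
      "spatial_ricci i j x - hess i j x / 2 = 1 / 4 * pd i u x * pd j u x"
      if "i \<noteq> 0" "j \<noteq> 0" for i j
    proof -
      have ric: "ricci g a b x = 0" for a b
        using vacuum x WU by (auto simp: vacuum_solution_def)
      have zero: "((\<lambda>_. 0) has_field_derivative 0) (at (x $ 0))" by simp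
      show "lap x + grad2 x / 2 = 0"
        using ric[of 0 0] \<epsilon> unfolding vac.ricci_M[OF x] ricci_of_conn_time[OF x zero] by auto
      show "spatial_ricci i j x - hess i j x / 2 = 1 / 4 * pd i u x * pd j u x"
        using ric[of i j] unfolding vac.ricci_M[OF x] ricci_of_conn_spatial[OF x zero that] by simp
    qed

    \<comment> \<open>By the third coupling relation the \<mu> dependence beyond exp (- X) is
      exactly 1 / s^2, the factor also carried by mu'' + 2 mu'^2.\<close>
    have "\<xi>\<^sub>3 * \<phi>t x = - X + - (2 * ln s)"
    proof -
      have "\<xi>\<^sub>3 * \<phi>t x = - \<beta> * u x - \<xi>\<^sub>1\<^sup>2 / \<kappa> * \<mu> (x $ 0)"
        using K(1) xi1 xi1' by (simp add: \<phi>_eq[OF x] c_def power2_eq_square field_simps)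
      also have "\<dots> = - X - (\<xi>\<^sub>1\<^sup>2 / \<kappa> - 2) * \<mu> (x $ 0)"
        by (simp add: X_def algebra_simps)
      also have "(\<xi>\<^sub>1\<^sup>2 / \<kappa> - 2) * \<mu> (x $ 0) = 2 * ln s"
        using K(3) by (simp add: mu s_def mult.assoc[symmetric])
      finally show ?thesis by simp
    qed
    then have "exp (\<xi>\<^sub>3 * \<phi>t x) = exp (- X) * exp (- (2 * ln s))"
      by (simp only: exp_add)
    also have "exp (- (2 * ln s)) = 1 / s\<^sup>2"
      using s_pos by (simp only: exp_minus exp_double exp_ln inverse_eq_divide)
    finally have "\<kappa> * v = exp (- X) * ((\<kappa> * V\<^sub>0) / s\<^sup>2)"
      by (simp add: v_def)
    then have v: "\<kappa> * v = - \<epsilon> * exp (- X) * (m' + 2 * (m (x $ 0))\<^sup>2)"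
      unfolding K(4) m'2 by (simp add: field_simps)
    \<comment> \<open>The differential equation for \<mu> left over by the 00 component; for a
      logarithm it reduces to the third coupling relation.\<close>
    have mm: "\<kappa> * (c * m (x $ 0))\<^sup>2 = 2 * (m (x $ 0))\<^sup>2 - 2 * m'"
    proof -
      have "\<kappa> * (c * m (x $ 0))\<^sup>2 - 2 * (m (x $ 0))\<^sup>2 = (\<xi>\<^sub>1\<^sup>2 / \<kappa> - 2) * \<xi>\<^sub>2 * (\<xi>\<^sub>2 * C\<^sup>2 / s\<^sup>2)"
        using \<open>\<kappa> > 0\<close> s_pos by (simp add: m c_def field_simps power2_eq_square)
      then show ?thesis unfolding K(3) by (simp add: m'_def)
    qed
    have expXY: "exp X * exp (- X) = 1" "exp Y * exp (- X) = exp ((1 - 2 * \<beta>) * u x)"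
      by (simp_all add: X_def Y_def algebra_simps flip: exp_add)

    have d\<phi>: "pd 0 \<phi>t x = c * m (x $ 0)" "i \<noteq> 0 \<Longrightarrow> pd i \<phi>t x = \<xi>\<^sub>0 * pd i u x" for i
    proof -
      note t = pd_time[OF x sol.\<mu>_deriv[OF x]]
      have "pd i \<phi>t x = \<xi>\<^sub>0 * pd i u x + (if i = 0 then c * m (x $ 0) else 0)" for i
      proof -
        have "pd i \<phi>t x = pd i (\<lambda>y. \<xi>\<^sub>0 * u y + c * \<mu> (y $ 0)) x"
          by (rule pd_cong[OF W x]) (rule \<phi>_eq)
        then show ?thesis
          using u_diff[OF x] t by (simp add: pd_add pd_cmult differentiable_mult)
      qed
      then show "pd 0 \<phi>t x = c * m (x $ 0)" "i \<noteq> 0 \<Longrightarrow> pd i \<phi>t x = \<xi>\<^sub>0 * pd i u x" for i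
        by (simp_all add: u_static[OF x])
    qed

    have ricci: "ricci gt a b x = \<kappa> * (pd a \<phi>t x * pd b \<phi>t x + gt x $ a $ b * v)" for a b
    proof -
      have mixed: "\<kappa> * (c * m (x $ 0) * (\<xi>\<^sub>0 * pd i u x)) = \<beta> * m (x $ 0) * pd i u x" for i
        using K(1) \<open>\<kappa> > 0\<close> by (simp add: c_def xi1')
      consider "a = 0" "b = 0" | "a = 0" "b \<noteq> 0" | "a \<noteq> 0" "b = 0" | "a \<noteq> 0" "b \<noteq> 0" by blast
      then show ?thesis
      proof cases
        case 1
        have "\<kappa> * (pd 0 \<phi>t x * pd 0 \<phi>t x + gt x $ 0 $ 0 * v)
            = \<kappa> * (c * m (x $ 0))\<^sup>2 + \<epsilon> * exp X * (\<kappa> * v)"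
          by (simp add: d\<phi> sol.M_00[OF x] X_def power2_eq_square algebra_simps)
        also have "\<epsilon> * exp X * (\<kappa> * v) = - \<epsilon>\<^sup>2 * (exp X * exp (- X)) * (m' + 2 * (m (x $ 0))\<^sup>2)"
          unfolding v by (simp add: power2_eq_square)
        also have "\<dots> = - (m' + 2 * (m (x $ 0))\<^sup>2)"
          unfolding \<epsilon> expXY by simp
        finally have "\<kappa> * (pd 0 \<phi>t x * pd 0 \<phi>t x + gt x $ 0 $ 0 * v) = - 3 * m'"
          unfolding mm by simp
        moreover have "ricci gt 0 0 x = - 3 * m'"
          \<comment> \<open>The first part of \<open>vac\<close> carries the premises on i and j; 1
            and 1 are just an admissible pair.\<close>
          unfolding sol.ricci_M[OF x] ricci_of_conn_time[OF x m_deriv] using vac(1)[of 1 1] by simp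
        ultimately show ?thesis using 1 by simp
      next
        case 2
        then show ?thesis
          using mixed[of b]
          by (auto simp: sol.ricci_M[OF x] ricci_of_conn_mixed[OF x m_deriv _ \<epsilon>] d\<phi> sol.M_0i[OF x])
      next
        case 3
        then show ?thesis
          using mixed[of a]
          by (auto simp: sol.ricci_M[OF x] ricci_of_conn_mixed[OF x m_deriv _ \<epsilon>] d\<phi> sol.M_i0[OF x] mult_ac)
      next
        case 4
        have "\<kappa> * (pd a \<phi>t x * pd b \<phi>t x + gt x $ a $ b * v)
            = (\<kappa> * \<xi>\<^sub>0\<^sup>2) * pd a u x * pd b u x + exp Y * h a b x * (\<kappa> * v)"
          using 4 by (simp add: d\<phi> sol.M_ij[OF x] Y_def power2_eq_square algebra_simps)
        also have "exp Y * h a b x * (\<kappa> * v)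
            = - \<epsilon> * (exp Y * exp (- X)) * h a b x * (m' + 2 * (m (x $ 0))\<^sup>2)"
          unfolding v by simp
        finally show ?thesis
          unfolding sol.ricci_M[OF x] ricci_of_conn_spatial[OF x m_deriv 4] vac(1)[OF 4] vac(2)[OF 4]
            K(2) expXY
          by (simp add: algebra_simps)
      qed
    qed

    have "transpose (gt x) = gt x" "invertible (gt x)"
      using gt_lor[OF x] lorentzian_invertible by (auto simp: lorentzian_def)
    from einstein_of_ricci[OF this ricci]
    have ein: "einstein gt a b x = \<kappa> * (pd a \<phi>t x * pd b \<phi>t x - gt x $ a $ b *
        (1 / 2 * (\<Sum>\<alpha>\<in>UNIV. \<Sum>\<beta>\<in>UNIV. ginv gt \<alpha> \<beta> x * pd \<alpha> \<phi>t x * pd \<beta> \<phi>t x) + v))" for a b .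
    have "box gt \<phi>t x = \<epsilon> * exp (- X) * c * (m' + 2 * (m (x $ 0))\<^sup>2)"
      using sol.box_M[OF x m_deriv \<phi>_eq] vac(1)[of 1 1] by (simp add: X_def)
    also have "\<dots> = - c * (\<kappa> * v)" unfolding v by simp
    \<comment> \<open>kappa c = xi1 = - xi3: the opposite signs of the two couplings produce the
      derivative of the exponential potential.\<close>
    also have "\<dots> = \<xi>\<^sub>3 * v" using xi1 \<open>\<kappa> > 0\<close> by (simp add: c_def)
    also have "\<dots> = deriv (\<lambda>s. V\<^sub>0 * exp (\<xi>\<^sub>3 * s)) (\<phi>t x)"
      by (rule DERIV_imp_deriv[symmetric]) (auto intro!: derivative_eq_intros simp: v_def)
    finally show ?thesis using ein by (simp add: v_def)
  qed

  show ?thesis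
    unfolding W_def[symmetric] einstein_scalar_solution_def lorentz_metric_on_def
    using gt_smooth gt_lor \<phi>_smooth field_eqs by blast
qed

end
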